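(* Let $F$ be the distribution function of a Gaussian random variable with mean $0$ and variance $2$, and let $$\theta=-\min_{\kappa>1}\frac1\kappa\log\big(1-F(-1)(1-e^{1-\kappa})\big)\approx 0.0833 .$$ Then $\theta>0$ is a universal constant such that the following holds for every $d\ge1$. Let $\Psi\in\mathcal B_0$, $V\in L^\infty(\mathbb R^d)$, let $\mathcal D\subset\mathbb R^d$ be a bounded convex open set, and let $\varphi$ be a non-zero solution of $$(\Psi(-\Delta)+V)\varphi=\lambda\varphi \ \text{ in } \mathcal D,\qquad \varphi=0 \ \text{ in } \mathcal D^c,$$ with eigenvalue $\lambda\in\mathbb R$. Assume that $|\varphi|$ attains a global maximum at $x^*\in\mathcal D$ and let $r=\operatorname{dist}(x^*,\partial\mathcal D)$. Then $$\|V^-\|_{L^\infty(\mathcal D)}-\inf_{\mathcal D}V^+ +\lambda\ \ge\ \theta\,\Psi(r^{-2}).$$ In particular, if $\Psi$ is strictly increasing, then $$\operatorname{dist}(x^*,\partial\mathcal D)\ \ge\ \frac{1}{\sqrt{\Psi^{-1}\Big(\frac{\|V^-\|_{L^\infty(\mathcal D)}-\inf_{\mathcal D}V^+ +\lambda}{\theta}\Big)}} .$$ (The constant $\theta$ does not depend on $\mathcal D$, $x^*$, $V$, $\Psi$ or $d$.)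
   Context: $\mathcal B_0$ is the set of Bernstein functions vanishing at zero: $f\in C^\infty((0,\infty))$, $f\ge0$, $(-1)^n f^{(n)}\le 0$ for all $n\ge1$, and $\lim_{u\downarrow0}f(u)=0$. For $\Psi\in\mathcal B_0$, $\Psi(-\Delta)$ is the operator with Fourier multiplier $\Psi(|y|^2)$. Let $(S^\Psi_t)_{t\ge0}$ be the subordinator with $\mathbb E[e^{-uS^\Psi_t}]=e^{-t\Psi(u)}$, and $(B_t)_{t\ge0}$ an independent $d$-dimensional Brownian motion running twice as fast as standard Brownian motion (each coordinate has variance $2t$). $X_t=B_{S^\Psi_t}$ is the corresponding subordinate Brownian motion; $\mathbb P^x,\mathbb E^x$ refer to the process started at $x$. $V^+=\max\{V,0\}$, $V^-=\max\{-V,0\}$. With $\tau_{\mathcal D}=\inf\{t>0: X_t\notin\mathcal D\}$, set $T^{\mathcal D,V}_tf(x)=\mathbb E^x\big[e^{-\int_0^tV(X_s)ds}f(X_t)\mathbf 1_{\{\tau_{\mathcal D}>t\}}\big]$, $x\in\mathcal D$; this semigroup has generator $-H^{\mathcal D,V}$, where $H^{\mathcal D,V}$ is the Friedrichs extension of $(\Psi(-\Delta)+V)|_{C_c^\infty(\mathcal D)}$. A non-zero solution $\varphi$ of the eigenvalue problem with eigenvalue $\lambda$ is a non-zero $\varphi\in L^2(\mathcal D)$ (extended by $0$ outside $\mathcal D$) with $H^{\mathcal D,V}\varphi=\lambda\varphi$, i.e. $T^{\mathcal D,V}_t\varphi=e^{-\lambda t}\varphi$ for all $t>0$, taken in the version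 for which this identity holds at every $x\in\mathcal D$. If $\Psi$ is bounded and the argument of $\Psi^{-1}$ is not in the range of $\Psi$, then $\Psi^{-1}$ is read as $+\infty$ and $1/\sqrt{\infty}=0$.
   Formalization: The semigroup is formed with a Borel representative of V obeying V's essential bounds at every point of D (inf of V^+ is the essential infimum); for bounded Ψ the pointwise semigroup depends on the representative and the claim fails for a bad one. *)

theory Defs
  imports "HOL-Probability.Probability"
begin

definition theta_fun :: "real \<Rightarrow> real" where
  "theta_fun \<kappa> = (1 / \<kappa>) *
     ln (1 - cdf (density lborel (\<lambda>x. ennreal (normal_density 0 (sqrt 2) x))) (-1)
             * (1 - exp (1 - \<kappa>)))"

definition theta :: real where
  "theta = - (INF \<kappa>\<in>{1<..}. theta_fun \<kappa>)"

text \<open>Only the values on the open half line matter; the behaviour of the total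
  function \<^term>\<open>\<Psi> :: real \<Rightarrow> real\<close> elsewhere is irrelevant.\<close>

definition bernstein0 :: "(real \<Rightarrow> real) \<Rightarrow> bool" where
  "bernstein0 \<Psi> \<longleftrightarrow>
     (\<forall>n. \<forall>u>0. (deriv ^^ n) \<Psi> field_differentiable at u) \<and>
     (\<forall>u>0. 0 \<le> \<Psi> u) \<and>
     (\<forall>n\<ge>1. \<forall>u>0. (-1) ^ n * (deriv ^^ n) \<Psi> u \<le> 0) \<and>
     (\<Psi> \<longlongrightarrow> 0) (at_right 0)"

text \<open>Processes are indexed by real times; only times \<^term>\<open>t \<ge> (0::real)\<close> are used.\<close>

definition independent_increments ::
    "'w measure \<Rightarrow> (real \<Rightarrow> 'w \<Rightarrow> 'a::real_normed_vector) \<Rightarrow> bool" where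
  "independent_increments M Z \<longleftrightarrow>
     (\<forall>(n::nat) (t :: nat \<Rightarrow> real). 0 \<le> t 0 \<longrightarrow> (\<forall>i<n. t i \<le> t (Suc i)) \<longrightarrow>
        prob_space.indep_vars M (\<lambda>_. borel) (\<lambda>i \<omega>. Z (t (Suc i)) \<omega> - Z (t i) \<omega>) {..<n})"

definition subordinator ::
    "'w measure \<Rightarrow> (real \<Rightarrow> real) \<Rightarrow> (real \<Rightarrow> 'w \<Rightarrow> real) \<Rightarrow> bool" where
  "subordinator M \<Psi> S \<longleftrightarrow>
     (\<forall>t\<ge>0. S t \<in> borel_measurable M) \<and>
     (AE \<omega> in M. S 0 \<omega> = 0 \<and> mono_on {0..} (\<lambda>t. S t \<omega>) \<and>
        (\<forall>t\<ge>0. continuous (at_right t) (\<lambda>s. S s \<omega>))) \<and>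
     independent_increments M S \<and>
     (\<forall>s\<ge>0. \<forall>h\<ge>0. distr M borel (\<lambda>\<omega>. S (s + h) \<omega> - S s \<omega>) = distr M borel (S h)) \<and>
     (\<forall>t\<ge>0. \<forall>u>0. prob_space.expectation M (\<lambda>\<omega>. exp (- u * S t \<omega>)) = exp (- t * \<Psi> u))"

text \<open>Brownian motion at double speed: the coordinates of the increment over
  \<^term>\<open>{s..t}\<close> are independent centred Gaussians with variance \<^term>\<open>2 * (t - s)\<close>.\<close>

definition brownian_motion2 ::
    "'w measure \<Rightarrow> (real \<Rightarrow> 'w \<Rightarrow> real ^ 'd) \<Rightarrow> bool" where
  "brownian_motion2 M B \<longleftrightarrow>
     (\<forall>t\<ge>0. B t \<in> borel_measurable M) \<and>
     (AE \<omega> in M. B 0 \<omega> = 0 \<and> continuous_on {0..} (\<lambda>t. B t \<omega>)) \<and>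
     independent_increments M B \<and>
     (\<forall>s\<ge>0. \<forall>t>s. distributed M lborel (\<lambda>\<omega>. B t \<omega> - B s \<omega>)
        (\<lambda>x. ennreal (\<Prod>i\<in>UNIV. normal_density 0 (sqrt (2 * (t - s))) (x $ i))))"

text \<open>Events determined by the whole process. (\<^const>\<open>prob_space.indep_var\<close> is not
  applicable to \<open>S\<close> and \<open>B\<close> because their values have different types.)\<close>

definition process_events ::
    "'w measure \<Rightarrow> (real \<Rightarrow> 'w \<Rightarrow> 'a::topological_space) \<Rightarrow> 'w set set" where
  "process_events M Z =
     {(\<lambda>\<omega>. \<lambda>t\<in>{0..}. Z t \<omega>) -` A \<inter> space M | A. A \<in> sets (PiM {0..} (\<lambda>_. borel))}"

definition subordinate_brownian_setting ::
    "'w measure \<Rightarrow> (real \<Rightarrow> real) \<Rightarrow> (real \<Rightarrow> 'w \<Rightarrow> real) \<Rightarrow> (real \<Rightarrow> 'w \<Rightarrow> real ^ 'd) \<Rightarrow> bool" where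
  "subordinate_brownian_setting M \<Psi> S B \<longleftrightarrow>
     prob_space M \<and> subordinator M \<Psi> S \<and> brownian_motion2 M B \<and>
     prob_space.indep_set M (process_events M S) (process_events M B)"

text \<open>The path of the subordinate process started at \<open>x\<close>; expectations under \<open>\<P>\<^sup>x\<close> are
  expectations under \<open>M\<close> of functionals of this path.\<close>

definition sbm_path ::
    "(real \<Rightarrow> 'w \<Rightarrow> real) \<Rightarrow> (real \<Rightarrow> 'w \<Rightarrow> real ^ 'd) \<Rightarrow> real ^ 'd \<Rightarrow> 'w \<Rightarrow> real \<Rightarrow> real ^ 'd" where
  "sbm_path S B x \<omega> t = x + B (S t \<omega>) \<omega>"

definition exit_time :: "'a set \<Rightarrow> (real \<Rightarrow> 'a) \<Rightarrow> ereal" where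
  "exit_time D p = Inf {ereal t | t. 0 < t \<and> p t \<notin> D}"

text \<open>Paths are regular only almost surely and exit times are hitting times of general closed
  sets, so that the integrand is measurable with respect to the completion of \<open>M\<close> only.\<close>

definition feynman_kac ::
    "'w measure \<Rightarrow> (real \<Rightarrow> 'w \<Rightarrow> real) \<Rightarrow> (real \<Rightarrow> 'w \<Rightarrow> real ^ 'd) \<Rightarrow>
     (real ^ 'd) set \<Rightarrow> (real ^ 'd \<Rightarrow> real) \<Rightarrow> real \<Rightarrow> (real ^ 'd \<Rightarrow> real) \<Rightarrow> real ^ 'd \<Rightarrow> real" where
  "feynman_kac M S B D V t f x =
     (\<integral>\<omega>. exp (- (LBINT s:{0..t}. V (sbm_path S B x \<omega> s))) * f (sbm_path S B x \<omega> t)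
          * indicator {\<omega>. ereal t < exit_time D (sbm_path S B x \<omega>)} \<omega> \<partial>(completion M))"

definition ess_sup_on :: "'a::euclidean_space set \<Rightarrow> ('a \<Rightarrow> real) \<Rightarrow> real" where
  "ess_sup_on D f = real_of_ereal (esssup (lebesgue_on D) (\<lambda>x. ereal (f x)))"

definition ess_inf_on :: "'a::euclidean_space set \<Rightarrow> ('a \<Rightarrow> real) \<Rightarrow> real" where
  "ess_inf_on D f = - ess_sup_on D (\<lambda>x. - f x)"

definition Linfty_norm_on :: "'a::euclidean_space set \<Rightarrow> ('a \<Rightarrow> real) \<Rightarrow> real" where
  "Linfty_norm_on D f = ess_sup_on D (\<lambda>x. \<bar>f x\<bar>)"

definition Linfty :: "('a::euclidean_space \<Rightarrow> real) \<Rightarrow> bool" where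
  "Linfty V \<longleftrightarrow> V \<in> borel_measurable lebesgue \<and> (\<exists>C. AE x in lebesgue. \<bar>V x\<bar> \<le> C)"

definition L2_on :: "'a::euclidean_space set \<Rightarrow> ('a \<Rightarrow> real) \<Rightarrow> bool" where
  "L2_on D f \<longleftrightarrow> f \<in> borel_measurable lebesgue \<and> (\<forall>x. x \<notin> D \<longrightarrow> f x = 0) \<and>
     integrable lebesgue (\<lambda>x. (f x)\<^sup>2)"

text \<open>A potential in \<open>L\<^sup>\<infinity>\<close> is an equivalence class, whereas the Feynman--Kac functional
  evaluates it along paths. If \<open>\<Psi>\<close> is unbounded, the process has a density at each positive
  time and the semigroup does not depend on the representative. If \<open>\<Psi>\<close> is bounded, the process
  stays at its starting point for a random time with positive probability, and a change of \<open>V\<close>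
  at a single point does change \<^term>\<open>feynman_kac M S B D V t f x\<close> at that point. The pointwise
  semigroup is therefore formed with a Borel representative that obeys the essential bounds of
  \<open>V\<close> everywhere in \<open>D\<close>.\<close>

definition represents_on ::
    "'a::euclidean_space set \<Rightarrow> ('a \<Rightarrow> real) \<Rightarrow> ('a \<Rightarrow> real) \<Rightarrow> bool" where
  "represents_on D V W \<longleftrightarrow> W \<in> borel_measurable borel \<and> (AE x in lebesgue. W x = V x) \<and>
     (\<forall>x\<in>D. ess_inf_on D V \<le> W x \<and> W x \<le> ess_sup_on D V)"

text \<open>The operator \<open>\<Psi>(-\<Delta>) + V\<close> on \<open>D\<close> with zero exterior condition is minus the generator of
  the semigroup, so its eigenvalue equation is \<open>T\<^sub>t \<phi> = exp (- l t) \<phi>\<close> for all \<open>t > 0\<close>, here in the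
  version of \<open>\<phi>\<close> for which this holds at every point of \<open>D\<close>. Non-zero is meant in \<open>L\<^sup>2\<close>.\<close>

definition eigenfunction ::
    "'w measure \<Rightarrow> (real \<Rightarrow> 'w \<Rightarrow> real) \<Rightarrow> (real \<Rightarrow> 'w \<Rightarrow> real ^ 'd) \<Rightarrow>
     (real ^ 'd) set \<Rightarrow> (real ^ 'd \<Rightarrow> real) \<Rightarrow> real \<Rightarrow> (real ^ 'd \<Rightarrow> real) \<Rightarrow> bool" where
  "eigenfunction M S B D V l \<phi> \<longleftrightarrow>
     L2_on D \<phi> \<and> \<not> (AE x in lebesgue. \<phi> x = 0) \<and>
     (\<exists>W. represents_on D V W \<and>
        (\<forall>t>0. \<forall>x\<in>D. feynman_kac M S B D W t \<phi> x = exp (- l * t) * \<phi> x))"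

definition inverse_ext :: "(real \<Rightarrow> real) \<Rightarrow> real \<Rightarrow> ereal" where
  "inverse_ext \<Psi> a =
     (if a \<in> \<Psi> ` {0<..} then ereal (the_inv_into {0<..} \<Psi> a) else \<infinity>)"

definition recip_sqrt :: "ereal \<Rightarrow> real" where
  "recip_sqrt u = (if u = \<infinity> then 0 else 1 / sqrt (real_of_ereal u))"

end

theory Submission
  imports Defs
begin

text \<open>
  Let \<open>r\<close> be the distance of the maximum point \<open>x\<close> to the boundary. A supporting hyperplane of \<open>D\<close>
  at a nearest boundary point puts \<open>D\<close> into a half space \<open>n \<bullet> (y - x) < r\<close>, so on survival up to
  time \<open>t\<close> we have \<open>n \<bullet> B (S t) < r\<close>. Since \<open>n \<bullet> B q\<close> is centred Gaussian with variance \<open>2 * q\<close> and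
  independent of \<open>S\<close>, this event fails with probability at least \<open>F (-1) * P (S t \<ge> r\<^sup>2)\<close>, and
  Markov's inequality for \<open>exp (- S t / r\<^sup>2)\<close> gives \<open>P (S t \<ge> r\<^sup>2) \<ge> 1 - exp (1 - t * \<Psi> (1 / r\<^sup>2))\<close>.
  Evaluating \<open>exp (- l * t) * \<phi> x = T\<^sub>t \<phi> x\<close> at the maximum and taking
  \<open>t = \<kappa> / \<Psi> (1 / r\<^sup>2)\<close> with the minimiser \<open>\<kappa>\<close> in the definition of \<open>\<theta>\<close> yields the bound.

  For \<open>\<theta>\<close> itself, put \<open>p = F (-1)\<close>. The weighted inequality of arithmetic and geometric means with
  weights \<open>1 - c\<close> and \<open>c\<close> bounds \<open>ln (1 - p + p * exp (1 - \<kappa>))\<close> below by an affine function of \<open>\<kappa>\<close>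
  with slope \<open>- c\<close>, with equality at one point. The number \<open>\<theta>\<close> is the value of \<open>c\<close> for which
  this function is linear, which locates it by a sign change.
\<close>

subsection \<open>The Gaussian tail\<close>

text \<open>The law of a component of \<open>B\<close> in a unit direction at time 1. An
  abbreviation keeps it syntactically equal to the measure inside \<open>theta_fun\<close>.\<close>

abbreviation gauss2 :: "real measure" where
  "gauss2 \<equiv> density lborel (\<lambda>x. ennreal (normal_density 0 (sqrt 2) x))"

lemma prob_space_gauss2: "prob_space gauss2"
  by (rule prob_space_normal_density) simp

lemma gauss2_uminus: "distr gauss2 borel uminus = gauss2"
proof -
  interpret prob_space gauss2 by (rule prob_space_gauss2)
  have "distributed gauss2 lborel (\<lambda>x. x) (normal_density 0 (sqrt 2))"
    by (auto simp: distributed_def intro!: distr_cong distr_id2)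
  from normal_density_affine[OF this, of "-1" 0]
  have "distr gauss2 lborel (\<lambda>x. - x) = gauss2"
    by (simp add: distributed_def)
  then show ?thesis by (simp cong: distr_cong)
qed

text \<open>The two closed half lines have equal mass by the symmetry under \<open>uminus\<close>;
  they cover the line and share only a null set.\<close>

lemma gauss2_half: "measure gauss2 {..0} = 1 / 2"
proof -
  interpret prob_space gauss2 by (rule prob_space_gauss2)
  have "measure gauss2 {..0} = measure (distr gauss2 borel uminus) {..0}"
    by (simp add: gauss2_uminus)
  also have "\<dots> = measure gauss2 {0..}"
    by (subst measure_distr) (auto intro!: arg_cong[where f="measure gauss2"])
  finally have sym: "measure gauss2 {..0} = measure gauss2 {0..}" .
  have zero: "AE x in gauss2. x \<noteq> 0"
    by (subst AE_density) (auto intro: AE_mp[OF AE_lborel_singleton[of 0]])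
  have "measure gauss2 {..0} + measure gauss2 {0<..} = measure gauss2 ({..0} \<union> {0<..})"
    by (intro finite_measure_Union[symmetric]) auto
  also have "{..0::real} \<union> {0<..} = space gauss2" by auto
  finally have "measure gauss2 {..0} + measure gauss2 {0<..} = 1" by (simp only: prob_space)
  moreover have "measure gauss2 {0<..} = measure gauss2 {0..}"
    by (rule measure_eq_AE) (use zero in \<open>auto elim!: eventually_mono\<close>)
  ultimately show ?thesis using sym by simp
qed

section \<open>Rational enclosure of the Gaussian tail\<close>

text \<open>The Lagrange remainder of order 4 is nonnegative, the one of order 5 is nonpositive
  because \<open>0 \<le> u\<close>. With \<open>u = x^2/4\<close> this encloses the Gaussian density
  between polynomials.\<close>

lemma exp_minus_bounds:
  fixes u :: real
  assumes "0 \<le> u"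
  shows "1 - u + u^2/2 - u^3/6 \<le> exp (- u)" "exp (- u) \<le> 1 - u + u^2/2 - u^3/6 + u^4/24"
proof -
  obtain s where "exp (- u) = (\<Sum>m<4. (- u) ^ m / fact m) + exp s / fact 4 * (- u) ^ 4"
    using Maclaurin_exp_le[of "- u" 4] by blast
  then have "exp (- u) = 1 - u + u^2/2 - u^3/6 + exp s / fact 4 * u ^ 4"
    by (simp add: eval_nat_numeral lessThan_Suc)
  then show "1 - u + u^2/2 - u^3/6 \<le> exp (- u)" by simp
  obtain s where "exp (- u) = (\<Sum>m<5. (- u) ^ m / fact m) + exp s / fact 5 * (- u) ^ 5"
    using Maclaurin_exp_le[of "- u" 5] by blast
  then have "exp (- u) = 1 - u + u^2/2 - u^3/6 + u^4/24 - exp s / fact 5 * u ^ 5"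
    by (simp add: eval_nat_numeral lessThan_Suc)
  moreover have "0 \<le> exp s / fact 5 * u ^ 5" using assms by simp
  ultimately show "exp (- u) \<le> 1 - u + u^2/2 - u^3/6 + u^4/24" by linarith
qed

text \<open>The factor \<open>sqrt (4 * pi)\<close> cancels the normalisation of the density, so the
  product is the integral of \<open>exp (- (x^2/4))\<close>, and the polynomial bounds integrate to
  rational numbers.\<close>

lemma gauss2_unit_interval:
  "measure gauss2 {-1..0} * sqrt (4 * pi) \<in> {0.92254..0.92257}"
proof -
  interpret prob_space gauss2 by (rule prob_space_gauss2)
  define c where "c = sqrt (4 * pi)"
  have c: "c > 0" by (simp add: c_def)
  define lo where "lo x = 1 - x^2/4 + (x^2/4)^2/2 - (x^2/4)^3/6" for x :: real
  define hi where "hi x = lo x + (x^2/4)^4/24" for x :: real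
  have eq: "normal_density 0 (sqrt 2) x = exp (- (x^2/4)) / c" for x
    by (simp add: normal_density_def c_def)
  have low: "lo x \<le> exp (- (x^2/4))" and high: "exp (- (x^2/4)) \<le> hi x" for x
    unfolding lo_def hi_def using exp_minus_bounds[of "x^2/4"] by auto
  \<comment> \<open>The integrals below are those of nonnegative functions. The polynomial
    \<open>lo\<close> becomes negative far from the origin, hence the restriction to the interval,
    whereas \<open>hi\<close> dominates an exponential everywhere.\<close>
  have lo_nn: "0 \<le> lo x" if "-1 \<le> x" "x \<le> 0" for x
  proof -
    have "x^2 \<le> 1" using that by (simp add: abs_square_le_1)
    then have "(x^2/4) \<le> 1" by simp
    moreover have "(x^2/4)^3 \<le> 1" using \<open>x^2 \<le> 1\<close> by (intro power_le_one) auto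
    moreover have "x^2/4 \<le> 1/4" using \<open>x^2 \<le> 1\<close> by simp
    ultimately show ?thesis unfolding lo_def
      using zero_le_power2[of "x^2/4"] by linarith
  qed
  have hi_nn: "0 \<le> hi x" for x using high[of x] exp_ge_zero[of "-(x^2/4)"] by linarith
  \<comment> \<open>Termwise antiderivatives, with denominators \<open>4*3\<close>,
    \<open>2*16*5\<close>, \<open>6*64*7\<close> and \<open>24*256*9\<close>.\<close>
  define Lo where "Lo x = (x - x^3/12 + x^5/160 - x^7/2688) / c" for x :: real
  define Hi where "Hi x = (x - x^3/12 + x^5/160 - x^7/2688 + x^9/55296) / c" for x :: real
  have "(Lo has_real_derivative lo x / c) (at x)" for x
    unfolding Lo_def lo_def using c
    by (auto intro!: derivative_eq_intros simp: field_simps eval_nat_numeral)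
  then have iLo: "(\<integral>\<^sup>+x. ennreal (lo x / c) * indicator {-1..0} x \<partial>lborel) = ennreal (Lo 0 - Lo (-1))"
    using c lo_nn by (intro nn_integral_FTC_Icc) (auto simp: lo_def)
  have "(Hi has_real_derivative hi x / c) (at x)" for x
    unfolding Hi_def hi_def lo_def using c
    by (auto intro!: derivative_eq_intros simp: field_simps eval_nat_numeral)
  then have iHi: "(\<integral>\<^sup>+x. ennreal (hi x / c) * indicator {-1..0} x \<partial>lborel) = ennreal (Hi 0 - Hi (-1))"
    using c hi_nn by (intro nn_integral_FTC_Icc) (auto simp: hi_def lo_def)
  have m: "ennreal (measure gauss2 {-1..0}) = (\<integral>\<^sup>+x. ennreal (exp (- (x^2/4)) / c) * indicator {-1..0} x \<partial>lborel)"
    by (subst emeasure_eq_measure[symmetric], subst emeasure_density) (simp_all add: eq)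
  have "ennreal (Lo 0 - Lo (-1)) \<le> ennreal (measure gauss2 {-1..0})"
    unfolding m iLo[symmetric] using low c
    by (intro nn_integral_mono mult_right_mono ennreal_leI divide_right_mono) auto
  then have "Lo 0 - Lo (-1) \<le> measure gauss2 {-1..0}" by (simp add: ennreal_le_iff)
  moreover have "ennreal (measure gauss2 {-1..0}) \<le> ennreal (Hi 0 - Hi (-1))"
    unfolding m iHi[symmetric] using high c
    by (intro nn_integral_mono mult_right_mono ennreal_leI divide_right_mono) auto
  then have "measure gauss2 {-1..0} \<le> Hi 0 - Hi (-1)"
    by (subst (asm) ennreal_le_iff) (use c in \<open>auto simp: Hi_def field_simps\<close>)
  moreover have "Lo 0 - Lo (-1) = (4133 / 4480) / c" "Hi 0 - Hi (-1) = (1785491 / 1935360) / c"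
    by (simp_all add: Lo_def Hi_def field_simps)
  ultimately have "(4133 / 4480) / c \<le> measure gauss2 {-1..0}"
    "measure gauss2 {-1..0} \<le> (1785491 / 1935360) / c" by simp_all
  then have "4133 / 4480 \<le> measure gauss2 {-1..0} * c" "measure gauss2 {-1..0} * c \<le> 1785491 / 1935360"
    by (simp_all only: pos_divide_le_eq[OF c] pos_le_divide_eq[OF c])
  then show ?thesis unfolding c_def by simp
qed

text \<open>The tail is one half minus the mass of the unit interval. Numerical bounds for
  \<open>pi\<close> enter only through \<open>sqrt (4 * pi)\<close>.\<close>

lemma gauss2_tail_bounds: "cdf gauss2 (-1) \<in> {0.23974..0.23976}"
proof -
  interpret prob_space gauss2 by (rule prob_space_gauss2)
  have ae: "AE x in gauss2. x \<noteq> -1"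
    by (subst AE_density) (auto intro: AE_mp[OF AE_lborel_singleton[of "-1"]])
  have "measure gauss2 {..0} = measure gauss2 ({..-1} \<union> {-1<..0})"
    by (intro arg_cong[where f="measure gauss2"]) auto
  also have "\<dots> = measure gauss2 {..-1} + measure gauss2 {-1<..0}"
    by (intro finite_measure_Union) auto
  also have "measure gauss2 {-1<..0} = measure gauss2 {-1..0}"
    by (rule measure_eq_AE) (use ae in \<open>auto elim!: eventually_mono\<close>)
  finally have p: "cdf gauss2 (-1) = 1/2 - measure gauss2 {-1..0}"
    using gauss2_half by (simp add: cdf_def)
  define c where "c = sqrt (4 * pi)"
  have c1: "3.544907 < c" unfolding c_def using pi_approx by (intro real_less_rsqrt) (simp add: power2_eq_square)
  have c2: "c < 3.544908" unfolding c_def using pi_approx by (intro real_less_lsqrt) (simp_all add: power2_eq_square)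
  define m where "m = measure gauss2 {-1..0}"
  have m0: "0 \<le> m" by (simp add: m_def)
  have "m * c \<in> {0.92254..0.92257}" using gauss2_unit_interval by (simp add: m_def c_def)
  moreover have "m * 3.544907 \<le> m * c" using c1 m0 by (intro mult_left_mono) auto
  moreover have "m * c \<le> m * 3.544908" using c2 m0 by (intro mult_left_mono) auto
  ultimately have "m * 3.544907 \<le> 0.92257" "0.92254 \<le> m * 3.544908"
    unfolding atLeastAtMost_iff by linarith+
  then show ?thesis unfolding p m_def[symmetric] by auto
qed

subsection \<open>The constant \<open>\<theta>\<close>\<close>

text \<open>For parameters between 0 and 1 this is \<open>c\<close> minus the relative entropy of
  the Bernoulli law with parameter \<open>c\<close> with respect to the one with parameter
  \<open>p\<close>. It is the intercept of the tangent of slope \<open>- c\<close> to the convex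
  function \<open>ln (1 - p + p * exp (1 - \<kappa>))\<close> of \<kappa>; at a root the tangent
  passes through the origin.\<close>

definition theta_eq :: "real \<Rightarrow> real \<Rightarrow> real" where
  "theta_eq p c = (1 - c) * ln ((1 - p) / (1 - c)) + c * (1 + ln (p / c))"

text \<open>Concavity of \<open>ln\<close> at the weighted mean \<open>y\<close> of \<open>a\<close>
  and \<open>b\<close>: the logarithm on the right is \<open>ln y\<close>, and \<open>ln b\<close>
  is affine in \<kappa>.\<close>

lemma theta_eq_AMGM:
  fixes p c \<kappa> :: real
  assumes p: "0 < p" "p < 1" and c: "0 < c" "c < 1"
  shows "theta_eq p c - c * \<kappa> \<le> ln (1 - p * (1 - exp (1 - \<kappa>)))"
proof -
  define a where "a = (1 - p) / (1 - c)"
  define b where "b = p * exp (1 - \<kappa>) / c"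
  define y where "y = (1 - c) * a + c * b"
  have ab: "0 < a" "0 < b" using p c by (auto simp: a_def b_def)
  then have y: "0 < y" using c by (auto simp: y_def intro!: add_pos_pos)
  have "b = (p / c) * exp (1 - \<kappa>)" by (simp add: b_def)
  then have lnb: "ln b = ln (p / c) + (1 - \<kappa>)" using p c by (simp only: ln_mult_pos divide_pos_pos exp_gt_zero ln_exp)
  \<comment> \<open>The tangent bound for \<open>ln\<close> at 1; the weighted sum of the right-hand
    sides vanishes because \<open>y\<close> is the weighted mean.\<close>
  have "ln a - ln y \<le> a / y - 1" "ln b - ln y \<le> b / y - 1"
    using ln_le_minus_one[of "a / y"] ln_le_minus_one[of "b / y"] ab y by (auto simp: ln_div)
  then have "(1 - c) * (ln a - ln y) + c * (ln b - ln y) \<le> (1 - c) * (a / y - 1) + c * (b / y - 1)"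
    using c by (intro add_mono mult_left_mono) auto
  also have "\<dots> = ((1 - c) * a + c * b) / y - 1" by (simp add: field_simps add_divide_distrib diff_divide_distrib)
  also have "\<dots> = 0" using y by (simp add: y_def)
  finally have "(1 - c) * ln a + c * ln b \<le> ln y" by (simp add: algebra_simps)
  moreover have "y = 1 - p * (1 - exp (1 - \<kappa>))"
    using c by (simp add: y_def a_def b_def) (simp add: algebra_simps)
  ultimately show ?thesis
    unfolding lnb by (simp add: theta_eq_def a_def algebra_simps)
qed

text \<open>Equality holds when the two averaged numbers coincide, that is, when
  \<open>p * exp (1 - \<kappa>) / c = (1 - p) / (1 - c)\<close>. Solving for \<kappa> gives the
  chosen value.\<close>

lemma theta_eq_AMGM_equality:
  fixes p c :: real
  assumes p: "0 < p" "p < 1" and c: "0 < c" "c < 1" and root: "theta_eq p c = 0"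
  defines "\<kappa> \<equiv> 1 + (ln (p / c) - ln ((1 - p) / (1 - c)))"
  shows "ln (1 - p * (1 - exp (1 - \<kappa>))) = - c * \<kappa>"
proof -
  have "exp (1 - \<kappa>) = exp (ln ((1 - p) / (1 - c)) - ln (p / c))"
    by (simp add: \<kappa>_def)
  also have "\<dots> = ((1 - p) / (1 - c)) / (p / c)"
    unfolding exp_diff using p c by (subst (1 2) exp_ln) auto
  finally have "p * exp (1 - \<kappa>) = c * ((1 - p) / (1 - c))" using p by simp
  then have "1 - p * (1 - exp (1 - \<kappa>)) = (1 - p) + c * ((1 - p) / (1 - c))"
    by (simp add: algebra_simps)
  also have "\<dots> = (1 - p) / (1 - c)" using c by (simp add: field_simps)
  finally have "ln (1 - p * (1 - exp (1 - \<kappa>))) = ln ((1 - p) / (1 - c))" by simp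
  then show ?thesis using root by (simp add: theta_eq_def \<kappa>_def algebra_simps)
qed

section \<open>Numerical location of \<theta>\<close>

lemma theta_eq_root:
  fixes p :: real
  assumes p: "p \<in> {0.23974..0.23976}"
  shows "\<exists>c. 0.0832 < c \<and> c < 0.0834 \<and> theta_eq p c = 0"
proof -
  have lo: "theta_eq p 0.0832 < 0"
  proof -
    \<comment> \<open>The first logarithm is largest at \<open>p = 0.23974\<close>, the second at
      \<open>p = 0.23976\<close>, where \<open>49 / 17\<close> is a simple fraction just above the
      quotient. The quotient below 1 is inverted so that the series bounds for \<open>ln\<close> are
      used above 1.\<close>
    have "ln ((1 - p) / (1 - 0.0832)) \<le> ln (7602600 / 9168000)" using p by (subst ln_le_cancel_iff) auto
    also have "\<dots> = - ln (9168000 / 7602600)" by (simp add: ln_div)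
    also have "\<dots> \<le> - 0.18722" using ln_approx_bounds[of "9168000/7602600" 3] by (simp add: eval_nat_numeral)
    finally have 1: "ln ((1 - p) / (1 - 0.0832)) \<le> - 0.18722" .
    have "ln (p / 0.0832) \<le> ln (49 / 17)" using p by (subst ln_le_cancel_iff) auto
    also have "\<dots> \<le> 1.0587" using ln_approx_bounds[of "49/17" 6] by (simp add: eval_nat_numeral)
    finally have "ln (p / 0.0832) \<le> 1.0587" .
    then have 2: "0.0832 * (1 + ln (p / 0.0832)) \<le> 0.0832 * (1 + 1.0587)" by (intro mult_left_mono) auto
    have "(1 - 0.0832) * ln ((1 - p) / (1 - 0.0832)) \<le> (1 - 0.0832) * (- 0.18722)"
      using 1 by (intro mult_left_mono) auto
    moreover have "(1 - 0.0832) * (- 0.18722) + 0.0832 * (1 + 1.0587) < (0::real)" by simp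
    ultimately show ?thesis using 2 unfolding theta_eq_def by linarith
  qed
  have hi: "0 < theta_eq p 0.0834"
  proof -
    \<comment> \<open>The ends of the range of \<open>p\<close> exchange their roles;
      \<open>365 / 127\<close> lies just below \<open>0.23974 / 0.0834\<close>.\<close>
    have "- 0.187038 \<le> - ln (9166000 / 7602400 :: real)" using ln_approx_bounds[of "9166000/7602400" 3] by (simp add: eval_nat_numeral)
    also have "- ln (9166000 / 7602400::real) = ln (7602400 / 9166000)" by (simp add: ln_div)
    also have "\<dots> \<le> ln ((1 - p) / (1 - 0.0834))" using p by (subst ln_le_cancel_iff) auto
    finally have 1: "- 0.187038 \<le> ln ((1 - p) / (1 - 0.0834))" .
    have "1.05568 \<le> ln (365 / 127::real)" using ln_approx_bounds[of "365/127" 6] by (simp add: eval_nat_numeral)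
    also have "\<dots> \<le> ln (p / 0.0834)" using p by (subst ln_le_cancel_iff) auto
    finally have "1.05568 \<le> ln (p / 0.0834)" .
    then have 2: "0.0834 * (1 + 1.05568) \<le> 0.0834 * (1 + ln (p / 0.0834))" by (intro mult_left_mono) auto
    have "(1 - 0.0834) * (- 0.187038) \<le> (1 - 0.0834) * ln ((1 - p) / (1 - 0.0834))"
      using 1 by (intro mult_left_mono) auto
    moreover have "0 < (1 - 0.0834) * (- 0.187038) + 0.0834 * (1 + 1.05568 :: real)" by simp
    ultimately show ?thesis using 2 unfolding theta_eq_def by linarith
  qed
  have "continuous_on {0.0832..0.0834} (theta_eq p)" unfolding theta_eq_def using p
    by (intro continuous_intros) auto
  with lo hi obtain c where "0.0832 \<le> c" "c \<le> 0.0834" "theta_eq p c = 0"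
    using IVT'[of "theta_eq p" "0.0832" 0 "0.0834"] by auto
  moreover have "c \<noteq> 0.0832" "c \<noteq> 0.0834" using lo hi \<open>theta_eq p c = 0\<close> by (metis less_irrefl)+
  ultimately show ?thesis by (intro exI[of _ c]) auto
qed

text \<open>At a root \<open>c\<close> of \<open>theta_eq p\<close>, dividing the affine bound by
  \<kappa> gives \<open>- c \<le> theta_fun \<kappa>\<close>, and the equality point attains it. So
  the infimum is a minimum and \<theta> is the root itself.\<close>

lemma theta_fun_minimum:
  obtains \<kappa> where "is_arg_min theta_fun (\<lambda>\<kappa>. 1 < \<kappa>) \<kappa>" "theta = - theta_fun \<kappa>"
    "0.0832 < theta" "theta < 0.0834"
proof -
  define p where "p = cdf gauss2 (-1)"
  have p: "p \<in> {0.23974..0.23976}" using gauss2_tail_bounds by (simp add: p_def)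
  from theta_eq_root[OF this] obtain c where c: "0.0832 < c" "c < 0.0834" "theta_eq p c = 0" by auto
  have tf: "theta_fun k = ln (1 - p * (1 - exp (1 - k))) / k" for k
    by (simp add: theta_fun_def p_def)
  have lower: "- c \<le> theta_fun k" if "1 < k" for k
    using theta_eq_AMGM[of p c k] p c that unfolding tf by (simp add: field_simps)
  define \<kappa> where "\<kappa> = 1 + (ln (p / c) - ln ((1 - p) / (1 - c)))"
  \<comment> \<open>From \<open>c < p\<close> follows \<open>(1 - p) / (1 - c) < 1 < p / c\<close>,
    which puts the equality point into the admissible range.\<close>
  have "ln ((1 - p) / (1 - c)) < ln (p / c)"
    using p c by (subst ln_less_cancel_iff) (auto simp: field_simps)
  then have k: "1 < \<kappa>" by (simp add: \<kappa>_def)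
  have "theta_fun \<kappa> = - c"
    using theta_eq_AMGM_equality[of p c] p c k unfolding tf \<kappa>_def[symmetric] by simp
  moreover from this have "theta = c" unfolding theta_def
    using k lower by (subst cInf_eq_minimum[of "- c"]) (auto simp: image_iff intro!: bexI[of _ \<kappa>])
  ultimately show ?thesis using that[of \<kappa>] k lower c by (force simp: is_arg_min_def not_less)
qed

subsection \<open>Gaussian vectors\<close>

text \<open>The product formula over the canonical basis, reindexed along the bijection from
  coordinates to \<open>axis i 1\<close>.\<close>

lemma nn_integral_lborel_vec_prod:
  fixes g :: "'d::finite \<Rightarrow> real \<Rightarrow> ennreal"
  assumes [measurable]: "\<And>i. g i \<in> borel_measurable borel"
  shows "(\<integral>\<^sup>+x. (\<Prod>i\<in>UNIV. g i (x $ i)) \<partial>(lborel :: (real^'d) measure)) = (\<Prod>i\<in>UNIV. \<integral>\<^sup>+t. g i t \<partial>lborel)"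
proof -
  define e :: "'d \<Rightarrow> real^'d" where "e i = axis i 1" for i
  have inj: "inj e" by (auto simp: e_def inj_def axis_eq_axis)
  have Basis: "Basis = range e" by (auto simp: Basis_vec_def e_def)
  define f where "f b = g (the_inv e b)" for b
  have f: "f (e i) = g i" for i by (simp add: f_def the_inv_f_f[OF inj])
  have "(\<integral>\<^sup>+x. (\<Prod>b\<in>Basis. f b (x \<bullet> b)) \<partial>(lborel :: (real^'d) measure)) = (\<Prod>b\<in>Basis. \<integral>\<^sup>+t. f b t \<partial>lborel)"
    by (rule nn_integral_lborel_prod) (auto simp: f_def)
  then show ?thesis
    unfolding Basis prod.reindex[OF inj] comp_def f
    by (simp add: e_def cart_eq_inner_axis[symmetric])
qed

context prob_space
begin

text \<open>Probabilities of boxes factorise, which yields both the marginals and the independence;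
  a side equal to \<open>UNIV\<close> contributes 1 because \<open>h\<close> is normalised.\<close>

lemma product_density_coordinates:
  fixes X :: "'a \<Rightarrow> real^'d" and h :: "real \<Rightarrow> real"
  assumes X: "distributed M lborel X (\<lambda>x. ennreal (\<Prod>i\<in>UNIV. h (x $ i)))"
    and [measurable]: "h \<in> borel_measurable borel" and h0: "\<And>t. 0 \<le> h t"
    and h1: "(\<integral>\<^sup>+t. h t \<partial>lborel) = 1"
  shows "distributed M lborel (\<lambda>\<omega>. X \<omega> $ i) h"
    and "indep_vars (\<lambda>_. borel) (\<lambda>i \<omega>. X \<omega> $ i) UNIV"
proof -
  have [measurable]: "X \<in> borel_measurable M" using distributed_measurable[OF X] by simp
  have coord [measurable]: "(\<lambda>\<omega>. X \<omega> $ i) \<in> borel_measurable M" for i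
    by (simp add: cart_eq_inner_axis)
  have box: "emeasure M {\<omega>\<in>space M. \<forall>i. X \<omega> $ i \<in> A i} = (\<Prod>i\<in>UNIV. \<integral>\<^sup>+t. ennreal (h t) * indicator (A i) t \<partial>lborel)"
    if [measurable]: "\<And>i. A i \<in> sets borel" for A
  proof -
    have B: "{x::real^'d. \<forall>i. x $ i \<in> A i} \<in> sets borel"
      by (simp add: cart_eq_inner_axis)
    have "emeasure M {\<omega>\<in>space M. \<forall>i. X \<omega> $ i \<in> A i} = emeasure M (X -` {x. \<forall>i. x $ i \<in> A i} \<inter> space M)"
      by (intro arg_cong[where f="emeasure M"]) auto
    also have "\<dots> = (\<integral>\<^sup>+x. ennreal (\<Prod>i\<in>UNIV. h (x $ i)) * indicator {x. \<forall>i. x $ i \<in> A i} x \<partial>lborel)"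
      by (rule distributed_emeasure[OF X]) (use B in simp)
    also have "\<dots> = (\<integral>\<^sup>+x. (\<Prod>i\<in>UNIV. ennreal (h (x $ i)) * indicator (A i) (x $ i)) \<partial>(lborel :: (real^'d) measure))"
    proof (rule nn_integral_cong)
      fix x :: "real^'d"
      have "indicator {x. \<forall>i. x $ i \<in> A i} x = (\<Prod>i\<in>UNIV. indicator (A i) (x $ i) :: ennreal)"
        by (auto simp: indicator_def prod_zero_iff)
      then show "ennreal (\<Prod>i\<in>UNIV. h (x $ i)) * indicator {x. \<forall>i. x $ i \<in> A i} x
          = (\<Prod>i\<in>UNIV. ennreal (h (x $ i)) * indicator (A i) (x $ i))"
        by (simp add: prod.distrib prod_ennreal h0)
    qed
    also have "\<dots> = (\<Prod>i\<in>UNIV. \<integral>\<^sup>+t. ennreal (h t) * indicator (A i) t \<partial>lborel)"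
      by (rule nn_integral_lborel_vec_prod) measurable
    finally show ?thesis .
  qed
  have single: "emeasure M {\<omega>\<in>space M. X \<omega> $ i \<in> A} = (\<integral>\<^sup>+t. ennreal (h t) * indicator A t \<partial>lborel)"
    if A: "A \<in> sets borel" for A i
  proof -
    have "emeasure M {\<omega>\<in>space M. X \<omega> $ i \<in> A}
        = emeasure M {\<omega>\<in>space M. \<forall>j. X \<omega> $ j \<in> (if j = i then A else UNIV)}"
      by (intro arg_cong[where f="emeasure M"]) auto
    also have "\<dots> = (\<Prod>j\<in>UNIV. \<integral>\<^sup>+t. ennreal (h t) * indicator (if j = i then A else UNIV) t \<partial>lborel)"
      by (rule box) (use A in auto)
    also have "\<dots> = (\<Prod>j\<in>UNIV. if j = i then \<integral>\<^sup>+t. ennreal (h t) * indicator A t \<partial>lborel else 1)"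
      by (rule prod.cong) (auto simp: h1)
    finally show ?thesis by simp
  qed
  show "distributed M lborel (\<lambda>\<omega>. X \<omega> $ i) h"
  proof -
    have "distr M lborel (\<lambda>\<omega>. X \<omega> $ i) = density lborel h"
    proof (rule measure_eqI)
      fix A assume "A \<in> sets (distr M lborel (\<lambda>\<omega>. X \<omega> $ i))"
      then have A: "A \<in> sets borel" by simp
      have "(\<lambda>\<omega>. X \<omega> $ i) -` A \<inter> space M = {\<omega>\<in>space M. X \<omega> $ i \<in> A}" by auto
      then show "emeasure (distr M lborel (\<lambda>\<omega>. X \<omega> $ i)) A = emeasure (density lborel h) A"
        using A by (simp add: emeasure_distr emeasure_density single)
    qed simp
    then show ?thesis by (simp add: distributed_def)
  qed
  show "indep_vars (\<lambda>_. borel) (\<lambda>i \<omega>. X \<omega> $ i) UNIV"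
  proof (subst indep_vars_finite[where E="\<lambda>_. sets borel"])
    show "\<forall>A\<in>UNIV \<rightarrow> sets borel. prob (\<Inter>j\<in>UNIV. (\<lambda>\<omega>. X \<omega> $ j) -` A j \<inter> space M)
        = (\<Prod>j\<in>UNIV. prob ((\<lambda>\<omega>. X \<omega> $ j) -` A j \<inter> space M))"
    proof
      fix A :: "'d \<Rightarrow> real set" assume "A \<in> UNIV \<rightarrow> sets borel"
      then have A: "A i \<in> sets borel" for i by auto
      have 1: "(\<Inter>j\<in>UNIV. (\<lambda>\<omega>. X \<omega> $ j) -` A j \<inter> space M) = {\<omega>\<in>space M. \<forall>i. X \<omega> $ i \<in> A i}"
        by auto
      have 2: "(\<lambda>\<omega>. X \<omega> $ j) -` A j \<inter> space M = {\<omega>\<in>space M. X \<omega> $ j \<in> A j}" for j by auto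
      have "ennreal (prob {\<omega>\<in>space M. \<forall>i. X \<omega> $ i \<in> A i})
          = (\<Prod>j\<in>UNIV. ennreal (prob {\<omega>\<in>space M. X \<omega> $ j \<in> A j}))"
        unfolding emeasure_eq_measure[symmetric] by (simp add: box single A)
      then show "prob (\<Inter>j\<in>UNIV. (\<lambda>\<omega>. X \<omega> $ j) -` A j \<inter> space M)
          = (\<Prod>j\<in>UNIV. prob ((\<lambda>\<omega>. X \<omega> $ j) -` A j \<inter> space M))"
        unfolding 1 unfolding 2 by (simp add: prod_ennreal prod_nonneg)
    qed
  qed (auto simp: Int_stable_def sets.sigma_sets_eq[of borel, simplified])
qed

text \<open>Rotation invariance: the variances of the independent normal summands add up to
  \<open>\<sigma>\<^sup>2\<close> because \<open>n\<close> is a unit vector.\<close>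

lemma gaussian_vector_inner:
  fixes X :: "'a \<Rightarrow> real^'d" and n :: "real^'d"
  assumes X: "distributed M lborel X (\<lambda>x. ennreal (\<Prod>i\<in>UNIV. normal_density 0 \<sigma> (x $ i)))"
    and \<sigma>: "0 < \<sigma>" and n: "norm n = 1"
  shows "distributed M lborel (\<lambda>\<omega>. n \<bullet> X \<omega>) (normal_density 0 \<sigma>)"
proof -
  have one: "(\<integral>\<^sup>+t. normal_density 0 \<sigma> t \<partial>lborel) = 1"
    using prob_space.emeasure_space_1[OF prob_space_normal_density[OF \<sigma>, of 0]]
    by (simp add: emeasure_density)
  note coords = product_density_coordinates[OF X _ _ one, simplified]
  \<comment> \<open>A vanishing coefficient produces a constant, which has no density, so the
    summation of normal variables runs over the other coordinates.\<close>
  define I where "I = {i. n $ i \<noteq> 0}"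
  have sq: "(\<Sum>i\<in>I. (n $ i)\<^sup>2) = 1"
  proof -
    have "(\<Sum>i\<in>I. (n $ i)\<^sup>2) = (\<Sum>i\<in>UNIV. (n $ i)\<^sup>2)"
      by (rule sum.mono_neutral_left) (auto simp: I_def)
    also have "\<dots> = (norm n)\<^sup>2" by (simp add: norm_vec_def L2_set_def sum_nonneg)
    finally show ?thesis using n by simp
  qed
  then have I: "I \<noteq> {}" by auto
  have "indep_vars (\<lambda>_. borel) (\<lambda>i \<omega>. n $ i * X \<omega> $ i) I"
    by (rule indep_vars_compose2[OF indep_vars_subset[OF coords(2)], where Y="\<lambda>i t. n $ i * t"]) auto
  moreover have "distributed M lborel (\<lambda>\<omega>. n $ i * X \<omega> $ i) (normal_density 0 (\<bar>n $ i\<bar> * \<sigma>))"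
    if "i \<in> I" for i
    using normal_density_affine[OF coords(1) \<sigma>, of "n $ i" 0 i] that by (simp add: I_def)
  ultimately have "distributed M lborel (\<lambda>\<omega>. \<Sum>i\<in>I. n $ i * X \<omega> $ i)
      (normal_density (\<Sum>i\<in>I. 0) (sqrt (\<Sum>i\<in>I. (\<bar>n $ i\<bar> * \<sigma>)\<^sup>2)))"
    using I \<sigma> by (intro sum_indep_normal) (auto simp: I_def)
  moreover have "(\<Sum>i\<in>I. (\<bar>n $ i\<bar> * \<sigma>)\<^sup>2) = \<sigma>\<^sup>2"
    using sq by (simp add: power_mult_distrib sum_distrib_right[symmetric])
  moreover have "(\<Sum>i\<in>I. n $ i * X \<omega> $ i) = n \<bullet> X \<omega>" for \<omega>
    unfolding inner_vec_def inner_real_def by (rule sum.mono_neutral_left) (auto simp: I_def)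
  ultimately show ?thesis using \<sigma> by simp
qed

text \<open>Division by \<open>- sqrt s\<close> turns the law of \<open>Y\<close> into
  \<open>gauss2\<close> and the event \<open>sqrt s \<le> Y\<close> into the lower tail
  \<open>{..-1}\<close>; this event is contained in \<open>r \<le> Y\<close> as
  \<open>r \<le> sqrt s\<close>.\<close>

lemma gaussian_upper_tail:
  assumes Y: "distributed M lborel Y (normal_density 0 (sqrt (2 * s)))"
    and r: "0 < r" "r\<^sup>2 \<le> s"
  shows "cdf gauss2 (-1) \<le> prob {\<omega>\<in>space M. r \<le> Y \<omega>}"
proof -
  have s: "0 < s" using r by (meson less_le_trans zero_less_power)
  have rs: "r \<le> sqrt s" using r by (simp add: real_le_rsqrt)
  have [measurable]: "Y \<in> borel_measurable M" using distributed_measurable[OF Y] by simp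
  have "distributed M lborel (\<lambda>\<omega>. 0 + (- (1 / sqrt s)) * Y \<omega>) 
      (normal_density (0 + (- (1 / sqrt s)) * 0) (\<bar>- (1 / sqrt s)\<bar> * sqrt (2 * s)))"
    by (rule normal_density_affine[OF Y]) (use s in auto)
  moreover have "\<bar>- (1 / sqrt s)\<bar> * sqrt (2 * s) = sqrt 2"
    using s by (simp add: real_sqrt_mult)
  ultimately have "distributed M lborel (\<lambda>\<omega>. - (Y \<omega> / sqrt s)) (normal_density 0 (sqrt 2))"
    by simp
  then have "distr M lborel (\<lambda>\<omega>. - (Y \<omega> / sqrt s)) = gauss2" by (simp add: distributed_def)
  then have "cdf gauss2 (-1) = measure (distr M lborel (\<lambda>\<omega>. - (Y \<omega> / sqrt s))) {..-1}"
    by (simp add: cdf_def)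
  also have "\<dots> = prob ((\<lambda>\<omega>. - (Y \<omega> / sqrt s)) -` {..-1} \<inter> space M)"
    by (rule measure_distr) auto
  also have "\<dots> \<le> prob {\<omega>\<in>space M. r \<le> Y \<omega>}"
    using s rs by (intro finite_measure_mono) (auto simp: le_divide_eq)
  finally show ?thesis .
qed

end

subsection \<open>Subordination\<close>

text \<open>\<open>T\<close> is approximated from above by the random times \<open>\<lceil>(n + 1) T\<rceil> / (n + 1)\<close>, which take
  countably many values and for which independence can be applied value by value.\<close>

lemma (in prob_space) prob_at_independent_time:
  fixes Y :: "real \<Rightarrow> 'a \<Rightarrow> real" and T :: "'a \<Rightarrow> real"
  assumes Y: "\<And>q. 0 \<le> q \<Longrightarrow> Y q \<in> borel_measurable M"
    and cont: "AE \<omega> in M. continuous_on {0..} (\<lambda>q. Y q \<omega>)"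
    and T [measurable]: "T \<in> borel_measurable M"
    and indep: "\<And>q A. 0 \<le> q \<Longrightarrow> A \<in> sets borel \<Longrightarrow>
      prob {\<omega>\<in>space M. T \<omega> \<in> A \<and> r \<le> Y q \<omega>} = prob {\<omega>\<in>space M. T \<omega> \<in> A} * prob {\<omega>\<in>space M. r \<le> Y q \<omega>}"
    and \<rho>: "0 < \<rho>"
    and lower: "\<And>q. \<rho> \<le> q \<Longrightarrow> p \<le> prob {\<omega>\<in>space M. r \<le> Y q \<omega>}"
  obtains A where "A \<in> sets M" "p * prob {\<omega>\<in>space M. \<rho> \<le> T \<omega>} \<le> prob A"
    "AE \<omega> in M. \<omega> \<in> A \<longrightarrow> r \<le> Y (T \<omega>) \<omega>"
proof -
  define N where "N n \<omega> = nat \<lceil>real (Suc n) * T \<omega>\<rceil>" for n \<omega>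
  define E where "E n k = {\<omega>\<in>space M. \<rho> \<le> T \<omega> \<and> N n \<omega> = k}" for n k
  define A where "A n = {\<omega>\<in>space M. \<rho> \<le> T \<omega> \<and> r \<le> Y (real (N n \<omega>) / real (Suc n)) \<omega>}" for n
  have Yk [measurable]: "Y (real k / real (Suc n)) \<in> borel_measurable M" for k n by (rule Y) simp
  have [measurable]: "N n \<in> measurable M (count_space UNIV)" for n unfolding N_def by measurable
  have E [measurable]: "E n k \<in> sets M" for n k unfolding E_def by measurable
  have A_UN: "A n = (\<Union>k. E n k \<inter> {\<omega>\<in>space M. r \<le> Y (real k / real (Suc n)) \<omega>})" for n
    by (auto simp: A_def E_def)
  have A [measurable]: "A n \<in> sets M" for n unfolding A_UN by measurable
  have N_ge: "T \<omega> \<le> real (N n \<omega>) / real (Suc n)" if "\<rho> \<le> T \<omega>" for n \<omega>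
  proof -
    have "real (Suc n) * T \<omega> \<le> real (N n \<omega>)"
      unfolding N_def by (rule real_nat_ceiling_ge)
    then show ?thesis by (simp add: field_simps del: of_nat_Suc)
  qed
  have N_le: "real (N n \<omega>) / real (Suc n) \<le> T \<omega> + 1 / real (Suc n)" if "\<rho> \<le> T \<omega>" for n \<omega>
  proof -
    have "0 \<le> real (Suc n) * T \<omega>" using that \<rho> by (intro mult_nonneg_nonneg) auto
    then have "real (N n \<omega>) = of_int \<lceil>real (Suc n) * T \<omega>\<rceil>"
      unfolding N_def by (intro of_nat_nat) (simp del: of_nat_Suc)
    then have "real (N n \<omega>) \<le> real (Suc n) * T \<omega> + 1" by linarith
    then show ?thesis by (simp add: field_simps del: of_nat_Suc)
  qed
  have prob_A: "p * prob {\<omega>\<in>space M. \<rho> \<le> T \<omega>} \<le> prob (A n)" for n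
  proof -
    have disj: "disjoint_family (E n)" by (auto simp: disjoint_family_on_def E_def)
    have UN: "(\<Union>k. E n k) = {\<omega>\<in>space M. \<rho> \<le> T \<omega>}" by (auto simp: E_def)
    have s1: "(\<lambda>k. prob (E n k)) sums prob {\<omega>\<in>space M. \<rho> \<le> T \<omega>}"
      unfolding UN[symmetric] by (rule finite_measure_UNION) (use disj in auto)
    have s2: "(\<lambda>k. prob (E n k \<inter> {\<omega>\<in>space M. r \<le> Y (real k / real (Suc n)) \<omega>})) sums prob (A n)"
      unfolding A_UN
      by (rule finite_measure_UNION)
        (use disj in \<open>auto simp: disjoint_family_on_def simp del: of_nat_Suc\<close>)
    \<comment> \<open>On a nonempty cell, rounding up makes the grid time at least \<rho>, where
      \<open>lower\<close> applies, and the cell is an event of \<open>T\<close> alone, so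
      independence applies too. On an empty cell both sides vanish.\<close>
    have "p * prob (E n k) \<le> prob (E n k \<inter> {\<omega>\<in>space M. r \<le> Y (real k / real (Suc n)) \<omega>})" for k
    proof (cases "E n k = {}")
      case False
      then obtain \<omega> where "\<rho> \<le> T \<omega>" "N n \<omega> = k" by (auto simp: E_def)
      then have k: "\<rho> \<le> real k / real (Suc n)" using N_ge[of \<omega> n] by simp
      define C where "C = {t. \<rho> \<le> t \<and> nat \<lceil>real (Suc n) * t\<rceil> = k}"
      have C: "C \<in> sets borel" unfolding C_def by measurable
      have EC: "E n k = {\<omega>\<in>space M. T \<omega> \<in> C}" by (auto simp: E_def C_def N_def)
      have "prob (E n k \<inter> {\<omega>\<in>space M. r \<le> Y (real k / real (Suc n)) \<omega>})
          = prob {\<omega>\<in>space M. T \<omega> \<in> C \<and> r \<le> Y (real k / real (Suc n)) \<omega>}"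
        unfolding EC by (intro arg_cong[where f=prob]) auto
      also have "\<dots> = prob (E n k) * prob {\<omega>\<in>space M. r \<le> Y (real k / real (Suc n)) \<omega>}"
        unfolding EC by (rule indep[OF _ C]) simp
      finally show ?thesis
        using mult_left_mono[OF lower[OF k] measure_nonneg[of M "E n k"]] by (simp add: mult.commute)
    qed simp
    from sums_le[OF this sums_mult[OF s1] s2] show ?thesis .
  qed
  \<comment> \<open>The events \<open>A n\<close> need not be monotone. Their limit superior is
    measurable and inherits the uniform lower bound by continuity from above; on it the inequality
    holds at infinitely many grid times, and path continuity carries it to \<open>T\<close>.\<close>
  define L where "L m = (\<Union>n\<in>{m..}. A n)" for m
  have L: "L m \<in> sets M" for m unfolding L_def by measurable
  have "decseq L" unfolding decseq_def L_def by (intro allI impI UN_mono) auto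
  then have "(\<lambda>m. prob (L m)) \<longlonglongrightarrow> prob (\<Inter>m. L m)"
    using L by (intro finite_Lim_measure_decseq) auto
  moreover have "p * prob {\<omega>\<in>space M. \<rho> \<le> T \<omega>} \<le> prob (L m)" for m
    using prob_A[of m] finite_measure_mono[OF _ L[of m], of "A m"] by (force simp: L_def)
  ultimately have "p * prob {\<omega>\<in>space M. \<rho> \<le> T \<omega>} \<le> prob (\<Inter>m. L m)"
    by (intro LIMSEQ_le_const) auto
  moreover have "AE \<omega> in M. \<omega> \<in> (\<Inter>m. L m) \<longrightarrow> r \<le> Y (T \<omega>) \<omega>"
    using cont
  proof eventually_elim
    fix \<omega> assume c: "continuous_on {0..} (\<lambda>q. Y q \<omega>)"
    show "\<omega> \<in> (\<Inter>m. L m) \<longrightarrow> r \<le> Y (T \<omega>) \<omega>"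
    proof (intro impI)
      assume "\<omega> \<in> (\<Inter>m. L m)"
      then have io: "\<exists>n\<ge>m. \<omega> \<in> A n" for m by (auto simp: L_def)
      from io[of 0] have T\<omega>: "\<rho> \<le> T \<omega>" by (auto simp: A_def)
      have "(\<lambda>n. real (N n \<omega>) / real (Suc n)) \<longlonglongrightarrow> T \<omega>"
      proof (rule tendsto_sandwich[where f="\<lambda>_. T \<omega>"])
        show "(\<lambda>n. T \<omega> + 1 / real (Suc n)) \<longlonglongrightarrow> T \<omega>"
          using tendsto_add[OF tendsto_const LIMSEQ_inverse_real_of_nat, of "T \<omega>"]
          by (simp add: inverse_eq_divide)
      qed (use N_ge[OF T\<omega>] N_le[OF T\<omega>] in auto)
      with c have lim: "(\<lambda>n. Y (real (N n \<omega>) / real (Suc n)) \<omega>) \<longlonglongrightarrow> Y (T \<omega>) \<omega>"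
        using T\<omega> \<rho> by (auto simp: continuous_on_sequentially comp_def)
      show "r \<le> Y (T \<omega>) \<omega>"
      proof (rule ccontr)
        assume "\<not> r \<le> Y (T \<omega>) \<omega>"
        then have "\<forall>\<^sub>F n in sequentially. Y (real (N n \<omega>) / real (Suc n)) \<omega> < r"
          by (intro order_tendstoD(2)[OF lim]) simp
        then obtain m where m: "\<And>n. m \<le> n \<Longrightarrow> Y (real (N n \<omega>) / real (Suc n)) \<omega> < r"
          by (auto simp: eventually_sequentially)
        from io[of m] obtain n where "m \<le> n" "\<omega> \<in> A n" by auto
        with m[of n] show False by (auto simp: A_def)
      qed
    qed
  qed
  ultimately show ?thesis using that[of "\<Inter>m. L m"] L by auto
qed

text \<open>One-time events are cylinder events; this brings the independence of the whole processes
  down to fixed times.\<close>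

lemma process_eventsI:
  assumes "0 \<le> t" "A \<in> sets borel"
  shows "{\<omega>\<in>space M. Z t \<omega> \<in> A} \<in> process_events M Z"
proof -
  have "(\<lambda>f. f t) -` A \<inter> space (PiM {0..} (\<lambda>_. borel)) \<in> sets (PiM {0..} (\<lambda>_. borel))"
    using assms by (intro measurable_sets[OF measurable_component_singleton]) auto
  moreover have "{\<omega>\<in>space M. Z t \<omega> \<in> A}
      = (\<lambda>\<omega>. \<lambda>s\<in>{0..}. Z s \<omega>) -` ((\<lambda>f. f t) -` A \<inter> space (PiM {0..} (\<lambda>_. borel))) \<inter> space M"
    using assms by (auto simp: space_PiM)
  ultimately show ?thesis unfolding process_events_def by blast
qed

text \<open>Markov's inequality at level \<open>exp (-1)\<close>, the value below which
  \<open>exp (- S t / a)\<close> does not fall while \<open>S t < a\<close>.\<close>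

lemma subordinator_lower_tail:
  assumes "prob_space M" "subordinator M \<Psi> S" "0 \<le> t" "0 < a"
  shows "1 - exp (1 - t * \<Psi> (1 / a)) \<le> measure M {\<omega>\<in>space M. a \<le> S t \<omega>}"
proof -
  interpret prob_space M by fact
  have [measurable]: "S t \<in> borel_measurable M" using assms by (simp add: subordinator_def)
  have "\<forall>t\<ge>0. \<forall>u>0. expectation (\<lambda>\<omega>. exp (- u * S t \<omega>)) = exp (- t * \<Psi> u)"
    using assms(2) unfolding subordinator_def by blast
  from this[rule_format, of t "1 / a"] assms
  have laplace: "expectation (\<lambda>\<omega>. exp (- (1 / a) * S t \<omega>)) = exp (- t * \<Psi> (1 / a))" by simp
  \<comment> \<open>A non-integrable function has integral 0 by convention, whereas the Laplace
    transform is positive.\<close>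
  have int: "integrable M (\<lambda>\<omega>. exp (- (1 / a) * S t \<omega>))"
    using not_integrable_integral_eq laplace by (metis exp_not_eq_zero)
  define L where "L = {\<omega>\<in>space M. S t \<omega> < a}"
  have [measurable]: "L \<in> sets M" unfolding L_def by measurable
  have "exp (-1) * prob L = expectation (\<lambda>\<omega>. exp (-1) * indicator L \<omega>)" by simp
  also have "\<dots> \<le> expectation (\<lambda>\<omega>. exp (- (1 / a) * S t \<omega>))"
  proof (rule integral_mono[OF _ int])
    show "exp (-1) * indicator L \<omega> \<le> exp (- (1 / a) * S t \<omega>)" for \<omega>
      using \<open>0 < a\<close> by (auto simp: indicator_def L_def field_simps)
  qed (auto intro!: integrable_mult_right integrable_real_indicator simp: emeasure_eq_measure)
  finally have "exp (-1) * prob L \<le> exp (- t * \<Psi> (1 / a))" unfolding laplace .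
  then have "exp 1 * (exp (-1) * prob L) \<le> exp 1 * exp (- t * \<Psi> (1 / a))"
    by (intro mult_left_mono) auto
  then have "prob L \<le> exp (1 - t * \<Psi> (1 / a))"
    by (simp add: mult.assoc[symmetric] exp_add[symmetric])
  moreover have "{\<omega>\<in>space M. a \<le> S t \<omega>} = space M - L" by (auto simp: L_def)
  ultimately show ?thesis by (simp add: prob_compl)
qed

text \<open>The threshold \<open>r\<^sup>2\<close> for the clock is where the standard deviation of
  \<open>n \<bullet> B q\<close> reaches \<open>r * sqrt 2\<close>, so that the tail beyond
  \<open>r\<close> is at least that of \<open>gauss2\<close> beyond 1. The set \<open>A\<close> is a
  measurable part of the event up to a null set.\<close>

lemma subordinate_brownian_leaves_halfspace:
  fixes B :: "real \<Rightarrow> 'w \<Rightarrow> real ^ 'd"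
  assumes setting: "subordinate_brownian_setting M \<Psi> S B"
    and t: "0 \<le> t" and r: "0 < r" and n: "norm n = 1"
  obtains A where "A \<in> sets M"
    "cdf gauss2 (-1) * (1 - exp (1 - t * \<Psi> (1 / r\<^sup>2))) \<le> measure M A"
    "AE \<omega> in M. \<omega> \<in> A \<longrightarrow> r \<le> n \<bullet> B (S t \<omega>) \<omega>"
proof -
  have M: "prob_space M" and S: "subordinator M \<Psi> S" and B: "brownian_motion2 M B"
    and ind: "prob_space.indep_set M (process_events M S) (process_events M B)"
    using setting by (auto simp: subordinate_brownian_setting_def)
  interpret prob_space M by fact
  have Bm: "B q \<in> borel_measurable M" if "0 \<le> q" for q
    using B that by (simp add: brownian_motion2_def)
  have Bpath: "AE \<omega> in M. B 0 \<omega> = 0 \<and> continuous_on {0..} (\<lambda>q. B q \<omega>)"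
    using B by (simp add: brownian_motion2_def)
  have half: "{x. r \<le> n \<bullet> x} \<in> sets borel" by measurable
  have tail: "cdf gauss2 (-1) \<le> prob {\<omega>\<in>space M. r \<le> n \<bullet> B q \<omega>}" if q: "r\<^sup>2 \<le> q" for q
  proof -
    have q0: "0 < q" using q r by (meson less_le_trans zero_less_power)
    have [measurable]: "B 0 \<in> borel_measurable M" "B q \<in> borel_measurable M"
      using q0 by (auto intro: Bm)
    have "\<forall>s\<ge>0. \<forall>t>s. distributed M lborel (\<lambda>\<omega>. B t \<omega> - B s \<omega>)
        (\<lambda>x. ennreal (\<Prod>i\<in>UNIV. normal_density 0 (sqrt (2 * (t - s))) (x $ i)))"
      using B by (simp add: brownian_motion2_def)
    from this[rule_format, of 0 q] q0
    have "distributed M lborel (\<lambda>\<omega>. B q \<omega> - B 0 \<omega>)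
        (\<lambda>x. ennreal (\<Prod>i\<in>UNIV. normal_density 0 (sqrt (2 * q)) (x $ i)))"
      by simp
    from gaussian_upper_tail[OF gaussian_vector_inner[OF this _ n] r q] q0
    have "cdf gauss2 (-1) \<le> prob {\<omega>\<in>space M. r \<le> n \<bullet> (B q \<omega> - B 0 \<omega>)}" by simp
    \<comment> \<open>\<open>B 0 = 0\<close> holds only almost surely, hence the comparison almost
      everywhere.\<close>
    also have "\<dots> \<le> prob {\<omega>\<in>space M. r \<le> n \<bullet> B q \<omega>}"
      using Bpath by (intro finite_measure_mono_AE) (auto elim: eventually_mono)
    finally show ?thesis .
  qed
  obtain A where A: "A \<in> sets M"
    "cdf gauss2 (-1) * prob {\<omega>\<in>space M. r\<^sup>2 \<le> S t \<omega>} \<le> prob A"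
    "AE \<omega> in M. \<omega> \<in> A \<longrightarrow> r \<le> n \<bullet> B (S t \<omega>) \<omega>"
  proof (rule prob_at_independent_time[where Y="\<lambda>q \<omega>. n \<bullet> B q \<omega>" and T="S t"
        and \<rho>="r\<^sup>2" and r=r and p="cdf gauss2 (-1)"])
    show "S t \<in> borel_measurable M" using S t by (simp add: subordinator_def)
    show "AE \<omega> in M. continuous_on {0..} (\<lambda>q. n \<bullet> B q \<omega>)"
      using Bpath by eventually_elim (auto intro!: continuous_intros)
    show "0 < r\<^sup>2" using r by simp
    fix q :: real
    show "(\<lambda>\<omega>. n \<bullet> B q \<omega>) \<in> borel_measurable M" if "0 \<le> q"
      using Bm[OF that] by measurable
    show "cdf gauss2 (-1) \<le> prob {\<omega>\<in>space M. r \<le> n \<bullet> B q \<omega>}" if "r\<^sup>2 \<le> q"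
      by (rule tail[OF that])
    fix A :: "real set"
    assume q: "0 \<le> q" and A: "A \<in> sets borel"
    have "prob ({\<omega>\<in>space M. S t \<omega> \<in> A} \<inter> {\<omega>\<in>space M. B q \<omega> \<in> {x. r \<le> n \<bullet> x}})
        = prob {\<omega>\<in>space M. S t \<omega> \<in> A} * prob {\<omega>\<in>space M. B q \<omega> \<in> {x. r \<le> n \<bullet> x}}"
      by (rule indep_setD[OF ind process_eventsI[OF t A] process_eventsI[OF q half]])
    moreover have "{\<omega>\<in>space M. S t \<omega> \<in> A} \<inter> {\<omega>\<in>space M. B q \<omega> \<in> {x. r \<le> n \<bullet> x}}
        = {\<omega>\<in>space M. S t \<omega> \<in> A \<and> r \<le> n \<bullet> B q \<omega>}" by auto
    ultimately show "prob {\<omega>\<in>space M. S t \<omega> \<in> A \<and> r \<le> n \<bullet> B q \<omega>}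
        = prob {\<omega>\<in>space M. S t \<omega> \<in> A} * prob {\<omega>\<in>space M. r \<le> n \<bullet> B q \<omega>}" by simp
  qed
  have "cdf gauss2 (-1) * (1 - exp (1 - t * \<Psi> (1 / r\<^sup>2)))
      \<le> cdf gauss2 (-1) * prob {\<omega>\<in>space M. r\<^sup>2 \<le> S t \<omega>}"
    using subordinator_lower_tail[OF M S t, of "r\<^sup>2"] r
    by (intro mult_left_mono) (auto simp: cdf_def)
  with A show ?thesis by (intro that[of A]) auto
qed

subsection \<open>Geometry, essential bounds and the Feynman--Kac functional\<close>

lemma convex_in_halfspace_at_infdist:
  fixes D :: "'a::euclidean_space set"
  assumes "bounded D" "convex D" "open D" "x \<in> D"
  obtains n where "norm n = 1" "0 < infdist x (frontier D)"
    "\<And>y. y \<in> D \<Longrightarrow> n \<bullet> (y - x) < infdist x (frontier D)"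
proof -
  \<comment> \<open>A nonempty bounded set is not the whole space. With an empty frontier
    \<open>infdist\<close> would be 0 by convention.\<close>
  have "frontier D \<noteq> {}"
    using assms not_bounded_UNIV by (auto simp: frontier_eq_empty)
  then obtain z where z: "z \<in> frontier D" "infdist x (frontier D) = dist x z"
    using infdist_attains_inf[of "frontier D" x] by auto
  have "z \<notin> D" using z \<open>open D\<close> by (auto simp: frontier_def interior_open)
  then have pos: "0 < infdist x (frontier D)" using z \<open>x \<in> D\<close> by auto
  have D': "rel_interior D = D" using \<open>open D\<close> by (rule rel_interior_open)
  have "z \<in> closure D" "z \<notin> rel_interior D" using z \<open>z \<notin> D\<close> by (auto simp: D' frontier_def)
  with \<open>convex D\<close> obtain a where a: "a \<noteq> 0" "\<And>y. y \<in> rel_interior D \<Longrightarrow> a \<bullet> z < a \<bullet> y"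
    by (rule supporting_hyperplane_relative_frontier) blast
  note a = a[unfolded D']
  \<comment> \<open>The supporting functional \<open>a\<close> is larger on \<open>D\<close> than at
    \<open>z\<close>; the sign change makes \<open>n\<close> the outward unit normal.\<close>
  define n where "n = - (a /\<^sub>R norm a)"
  have n: "norm n = 1" using a by (simp add: n_def)
  have "n \<bullet> (y - x) < infdist x (frontier D)" if "y \<in> D" for y
  proof -
    have "n \<bullet> y < n \<bullet> z" using a(2)[OF that] a(1) by (simp add: n_def divide_simps)
    then have "n \<bullet> (y - x) < n \<bullet> (z - x)" by (simp add: inner_diff_right)
    also have "\<dots> \<le> norm n * norm (z - x)" by (rule norm_cauchy_schwarz)
    finally show ?thesis using z n by (simp add: dist_norm norm_minus_commute)
  qed
  with n pos show ?thesis by (rule that)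
qed

section \<open>Essential bounds\<close>

text \<open>\<open>real_of_ereal\<close> sends infinite values to 0, so finiteness is the point: the
  bound \<open>C\<close> excludes the value \<infinity>, and the positive measure of a nonempty open
  set excludes the value -\<infinity>.\<close>

lemma ess_sup_on_bounds:
  fixes f :: "'a::euclidean_space \<Rightarrow> real"
  assumes D: "open D" "D \<noteq> {}" and f: "f \<in> borel_measurable lebesgue"
    and C: "AE x in lebesgue. \<bar>f x\<bar> \<le> C"
  shows AE_le_ess_sup_on: "AE x in lebesgue_on D. f x \<le> ess_sup_on D f"
    and ess_sup_on_le: "\<And>c. AE x in lebesgue_on D. f x \<le> c \<Longrightarrow> ess_sup_on D f \<le> c"
proof -
  have D': "D \<in> sets lebesgue" using D by (simp add: borel_open)
  have fm [measurable]: "f \<in> borel_measurable (lebesgue_on D)"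
    using f D' by (simp add: measurable_restrict_space1)
  have C': "AE x in lebesgue_on D. \<bar>f x\<bar> \<le> C"
    using C D' by (subst AE_restrict_space_iff) (auto elim: eventually_mono)
  have nonnull: "\<not> (AE x in lebesgue_on D. False)"
  proof
    assume "AE x in lebesgue_on D. False"
    then have "AE x in lebesgue. x \<notin> D" using D' by (subst (asm) AE_restrict_space_iff) auto
    then have "D \<in> null_sets lebesgue" using D' by (subst AE_iff_null_sets) auto
    then show False using D open_not_negligible[of D] by (simp add: negligible_iff_null_sets)
  qed
  define e where "e = esssup (lebesgue_on D) (\<lambda>x. ereal (f x))"
  have le: "AE x in lebesgue_on D. ereal (f x) \<le> e" unfolding e_def by (rule esssup_AE)
  have up: "e \<le> ereal c" if "AE x in lebesgue_on D. f x \<le> c" for c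
    unfolding e_def by (rule esssup_I) (use that in auto)
  have "e \<le> ereal C" using C' by (intro up) (auto elim: eventually_mono)
  moreover have "e \<noteq> - \<infinity>" using le nonnull by auto
  ultimately obtain e' where e': "e = ereal e'" by (cases e) auto
  then have ess: "ess_sup_on D f = e'" by (simp add: ess_sup_on_def e_def)
  show "AE x in lebesgue_on D. f x \<le> ess_sup_on D f" using le by (simp add: e' ess)
  show "ess_sup_on D f \<le> c" if "AE x in lebesgue_on D. f x \<le> c" for c
    using up[OF that] by (simp add: e' ess)
qed

text \<open>Pointwise \<open>- V\<close> is the negative part minus the positive part, and the
  essential supremum is subadditive. This passes from the infimum of \<open>V\<close>, which the
  path estimate yields, to the two separate terms of the theorem.\<close>

lemma ess_inf_on_decomposition:
  fixes V :: "'a::euclidean_space \<Rightarrow> real"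
  assumes D: "open D" "D \<noteq> {}" and V: "Linfty V"
  shows "ess_inf_on D (\<lambda>y. max (V y) 0) - Linfty_norm_on D (\<lambda>y. max (- V y) 0) \<le> ess_inf_on D V"
proof -
  obtain C where [measurable]: "V \<in> borel_measurable lebesgue" and C: "AE x in lebesgue. \<bar>V x\<bar> \<le> C"
    using V by (auto simp: Linfty_def)
  have 1: "AE x in lebesgue_on D. \<bar>max (- V x) 0\<bar> \<le> ess_sup_on D (\<lambda>y. \<bar>max (- V y) 0\<bar>)"
    using C by (intro AE_le_ess_sup_on[OF D, where C=C]) (auto elim: eventually_mono)
  have 2: "AE x in lebesgue_on D. - max (V x) 0 \<le> ess_sup_on D (\<lambda>y. - max (V y) 0)"
    using C by (intro AE_le_ess_sup_on[OF D, where C=C]) (auto elim: eventually_mono)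
  have "ess_sup_on D (\<lambda>y. - V y)
      \<le> ess_sup_on D (\<lambda>y. \<bar>max (- V y) 0\<bar>) + ess_sup_on D (\<lambda>y. - max (V y) 0)"
  proof (rule ess_sup_on_le[OF D])
    show "AE x in lebesgue_on D. - V x
        \<le> ess_sup_on D (\<lambda>y. \<bar>max (- V y) 0\<bar>) + ess_sup_on D (\<lambda>y. - max (V y) 0)"
      using 1 2 by eventually_elim auto
    show "AE x in lebesgue. \<bar>- V x\<bar> \<le> C" using C by simp
  qed simp
  then show ?thesis by (simp add: ess_inf_on_def Linfty_norm_on_def)
qed

section \<open>The Feynman--Kac functional along surviving paths\<close>

lemma exit_time_gt_imp_mem:
  assumes "ereal t < exit_time D p" "0 < s" "s \<le> t"
  shows "p s \<in> D"
proof (rule ccontr)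
  assume "p s \<notin> D"
  then have "exit_time D p \<le> ereal s"
    unfolding exit_time_def using assms by (intro Inf_lower) auto
  also have "\<dots> \<le> ereal t" using assms by simp
  finally show False using assms by simp
qed

text \<open>A monotone clock followed by a continuous path is Borel, so the bounded integrand is
  integrable and the integral is monotone. The bound \<open>C\<close> serves integrability:
  otherwise the integral could be 0 by convention.\<close>

lemma subordinate_path_integral_ge:
  fixes b :: "real \<Rightarrow> 'a::euclidean_space" and \<sigma> :: "real \<Rightarrow> real" and W :: "'a \<Rightarrow> real"
  assumes \<sigma>: "mono_on {0..} \<sigma>" "\<sigma> 0 = 0" and b: "continuous_on {0..} b"
    and W: "W \<in> borel_measurable borel"
    and D: "\<And>s. 0 \<le> s \<Longrightarrow> s \<le> t \<Longrightarrow> x + b (\<sigma> s) \<in> D"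
    and m: "\<And>y. y \<in> D \<Longrightarrow> m \<le> W y" and C: "\<And>y. y \<in> D \<Longrightarrow> W y \<le> C" and t: "0 \<le> t"
  shows "m * t \<le> (LBINT s:{0..t}. W (x + b (\<sigma> s)))"
proof -
  have nn: "0 \<le> \<sigma> s" if "0 \<le> s" for s
    using mono_onD[OF \<sigma>(1), of 0 s] \<sigma>(2) that by simp
  have "\<sigma> \<in> borel_measurable (restrict_space borel {0..})"
    using \<sigma>(1) by (rule borel_measurable_mono_on_fnc)
  then have "\<sigma> \<in> measurable (restrict_space borel {0..}) (restrict_space borel {0..})"
    by (intro measurable_restrict_space2) (auto simp: space_restrict_space nn)
  moreover have "b \<in> measurable (restrict_space borel {0..}) borel"
    using b by (rule borel_measurable_continuous_on_restrict)
  ultimately have "(\<lambda>s. b (\<sigma> s)) \<in> borel_measurable (restrict_space borel {0..})"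
    by (rule measurable_compose)
  then have "(\<lambda>s. W (x + b (\<sigma> s))) \<in> borel_measurable (restrict_space borel {0..})"
    using W by measurable
  then have [measurable]: "(\<lambda>s. indicator {0..} s *\<^sub>R W (x + b (\<sigma> s))) \<in> borel_measurable borel"
    by (subst (asm) borel_measurable_restrict_space_iff) auto
  have eq: "indicator {0..t} s *\<^sub>R W (x + b (\<sigma> s))
      = indicator {0..t} s *\<^sub>R (indicator {0..} s *\<^sub>R W (x + b (\<sigma> s)))" for s
    by (simp add: indicator_def)
  have fin: "integrable lborel (indicat_real {0..t})"
    by (intro integrable_real_indicator) (auto simp: emeasure_lborel_Icc_eq)
  have int: "set_integrable lborel {0..t} (\<lambda>s. W (x + b (\<sigma> s)))"
    unfolding set_integrable_def
  proof (rule Bochner_Integration.integrable_bound[where f="\<lambda>s. indicator {0..t} s *\<^sub>R max \<bar>m\<bar> \<bar>C\<bar>"])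
    show "integrable lborel (\<lambda>s. indicator {0..t} s *\<^sub>R max \<bar>m\<bar> \<bar>C\<bar>)" using fin by simp
    show "(\<lambda>s. indicator {0..t} s *\<^sub>R W (x + b (\<sigma> s))) \<in> borel_measurable lborel"
      unfolding eq by measurable
    show "AE s in lborel. norm (indicator {0..t} s *\<^sub>R W (x + b (\<sigma> s)))
        \<le> norm (indicator {0..t} s *\<^sub>R max \<bar>m\<bar> \<bar>C\<bar>)"
    proof (rule AE_I2)
      fix s
      show "norm (indicator {0..t} s *\<^sub>R W (x + b (\<sigma> s))) \<le> norm (indicator {0..t} s *\<^sub>R max \<bar>m\<bar> \<bar>C\<bar>)"
        using m[OF D, of s] C[OF D, of s] by (cases "s \<in> {0..t}") auto
    qed
  qed
  have "m * t = (LBINT s:{0..t}. m)" using t by (simp add: set_lebesgue_integral_def)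
  also have "\<dots> \<le> (LBINT s:{0..t}. W (x + b (\<sigma> s)))"
    using int fin by (intro set_integral_mono) (auto simp: set_integrable_def intro!: m D)
  finally show ?thesis .
qed

text \<open>The integrand vanishes unless the path survives in \<open>D\<close>; then it is at most
  \<open>exp (- m * t) * K\<close>, and almost surely \<omega> lies outside
  \<open>A\<close>.\<close>

lemma feynman_kac_bound:
  fixes B :: "real \<Rightarrow> 'w \<Rightarrow> real ^ 'd"
  assumes setting: "subordinate_brownian_setting M \<Psi> S B"
    and x: "x \<in> D" and t: "0 < t" and W: "W \<in> borel_measurable borel"
    and m: "\<And>y. y \<in> D \<Longrightarrow> m \<le> W y" and C: "\<And>y. y \<in> D \<Longrightarrow> W y \<le> C"
    and \<phi>: "\<And>y. \<bar>\<phi> y\<bar> \<le> K"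
    and A: "A \<in> sets M" "AE \<omega> in M. \<omega> \<in> A \<longrightarrow> sbm_path S B x \<omega> t \<notin> D"
  shows "\<bar>feynman_kac M S B D W t \<phi> x\<bar> \<le> exp (- m * t) * K * (1 - measure M A)"
proof -
  interpret prob_space M using setting by (simp add: subordinate_brownian_setting_def)
  have K: "0 \<le> K" using \<phi>[of x] by (meson abs_ge_zero order_trans)
  define c where "c = exp (- m * t) * K"
  have c: "0 \<le> c" using K by (simp add: c_def)
  define f where "f \<omega> = exp (- (LBINT s:{0..t}. W (sbm_path S B x \<omega> s))) * \<phi> (sbm_path S B x \<omega> t)
          * indicator {\<omega>. ereal t < exit_time D (sbm_path S B x \<omega>)} \<omega>" for \<omega>
  have S: "AE \<omega> in M. S 0 \<omega> = 0 \<and> mono_on {0..} (\<lambda>t. S t \<omega>) \<and>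
        (\<forall>t\<ge>0. continuous (at_right t) (\<lambda>s. S s \<omega>))"
    using setting by (simp add: subordinate_brownian_setting_def subordinator_def)
  have B: "AE \<omega> in M. B 0 \<omega> = 0 \<and> continuous_on {0..} (\<lambda>t. B t \<omega>)"
    using setting by (simp add: subordinate_brownian_setting_def brownian_motion2_def)
  have "AE \<omega> in M. \<bar>f \<omega>\<bar> \<le> c * indicator (space M - A) \<omega>"
    using S B A(2) AE_space
  proof eventually_elim
    fix \<omega>
    assume S\<omega>: "S 0 \<omega> = 0 \<and> mono_on {0..} (\<lambda>t. S t \<omega>) \<and>
        (\<forall>t\<ge>0. continuous (at_right t) (\<lambda>s. S s \<omega>))"
      and B\<omega>: "B 0 \<omega> = 0 \<and> continuous_on {0..} (\<lambda>t. B t \<omega>)"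
      and A\<omega>: "\<omega> \<in> A \<longrightarrow> sbm_path S B x \<omega> t \<notin> D" and \<omega>: "\<omega> \<in> space M"
    show "\<bar>f \<omega>\<bar> \<le> c * indicator (space M - A) \<omega>"
    proof (cases "ereal t < exit_time D (sbm_path S B x \<omega>)")
      case False
      then show ?thesis using c by (simp add: f_def)
    next
      case True
      \<comment> \<open>The exit time disregards time 0, where the path is at \<open>x\<close>
        because \<open>S\<close> and \<open>B\<close> start at 0.\<close>
      have path: "sbm_path S B x \<omega> s \<in> D" if "0 \<le> s" "s \<le> t" for s
        using exit_time_gt_imp_mem[OF True _ that(2)] S\<omega> B\<omega> x that(1)
        by (cases "s = 0") (auto simp: sbm_path_def)
      have "m * t \<le> (LBINT s:{0..t}. W (sbm_path S B x \<omega> s))"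
        unfolding sbm_path_def
        by (rule subordinate_path_integral_ge[where D=D and C=C and \<sigma>="\<lambda>s. S s \<omega>" and b="\<lambda>q. B q \<omega>"])
          (use S\<omega> B\<omega> W path m C t in \<open>simp_all add: sbm_path_def\<close>)
      then have e: "exp (- (LBINT s:{0..t}. W (sbm_path S B x \<omega> s))) \<le> exp (- m * t)" by simp
      have "\<bar>f \<omega>\<bar> = exp (- (LBINT s:{0..t}. W (sbm_path S B x \<omega> s))) * \<bar>\<phi> (sbm_path S B x \<omega> t)\<bar>"
        unfolding f_def using True by (simp add: abs_mult)
      also have "\<dots> \<le> c" unfolding c_def using e \<phi> by (intro mult_mono) auto
      finally have "\<bar>f \<omega>\<bar> \<le> c" .
      moreover have "\<omega> \<notin> A" using A\<omega> path[of t] t by auto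
      ultimately show ?thesis using \<omega> by simp
    qed
  qed
  then have ae: "AE \<omega> in completion M. \<bar>f \<omega>\<bar> \<le> c * indicator (space M - A) \<omega>"
    by (rule AE_completion)
  have ind: "integrable M (\<lambda>\<omega>. c * indicator (space M - A) \<omega>)"
    using A by (intro integrable_mult_right) (auto simp: emeasure_eq_measure)
  then have indc: "integrable (completion M) (\<lambda>\<omega>. c * indicator (space M - A) \<omega>)"
    by (subst integrable_completion) auto
  \<comment> \<open>Measurability of \<open>f\<close> is not established; without integrability the
    integral is 0 and the bound is trivial.\<close>
  have "\<bar>integral\<^sup>L (completion M) f\<bar> \<le> c * (1 - prob A)"
  proof (cases "integrable (completion M) f")
    case True
    then have "\<bar>integral\<^sup>L (completion M) f\<bar> \<le> (\<integral>\<omega>. \<bar>f \<omega>\<bar> \<partial>completion M)"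
      by (intro integral_abs_bound)
    also have "\<dots> \<le> (\<integral>\<omega>. c * indicator (space M - A) \<omega> \<partial>completion M)"
      using True indc ae by (intro integral_mono_AE) auto
    also have "\<dots> = (\<integral>\<omega>. c * indicator (space M - A) \<omega> \<partial>M)"
      using ind by (intro integral_completion) auto
    also have "\<dots> = c * (1 - prob A)" using A by (simp add: prob_compl)
    finally show ?thesis .
  next
    case False
    then show ?thesis using c by (simp add: not_integrable_integral_eq)
  qed
  then show ?thesis by (simp add: feynman_kac_def f_def[abs_def] c_def)
qed

subsection \<open>The location of maxima\<close>

text \<open>At the maximum point \<open>\<bar>\<phi> x\<bar>\<close> also bounds \<phi> globally, so
  it cancels from the eigenvalue identity and leaves an inequality in \<open>t\<close> alone, which
  is then optimised.\<close>

lemma eigenfunction_maximum_bound: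
  fixes B :: "real \<Rightarrow> 'w \<Rightarrow> real ^ 'd"
  assumes \<Psi>: "0 \<le> \<Psi> (1 / r\<^sup>2)" and setting: "subordinate_brownian_setting M \<Psi> S B"
    and V: "Linfty V" and D: "bounded D" "convex D" "open D"
    and eig: "eigenfunction M S B D V l \<phi>" and x: "x \<in> D" and max: "\<And>y. \<bar>\<phi> y\<bar> \<le> \<bar>\<phi> x\<bar>"
    and r: "r = infdist x (frontier D)"
  shows "theta * \<Psi> (1 / r\<^sup>2) \<le> l - ess_inf_on D V"
proof -
  interpret prob_space M using setting by (simp add: subordinate_brownian_setting_def)
  define E where "E = l - ess_inf_on D V"
  define p where "p = cdf gauss2 (-1)"
  have p: "0 < p" "p < 1" using gauss2_tail_bounds by (auto simp: p_def)
  obtain W where W: "represents_on D V W"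
    and eq: "\<And>t. 0 < t \<Longrightarrow> feynman_kac M S B D W t \<phi> x = exp (- l * t) * \<phi> x"
    using eig x unfolding eigenfunction_def by blast
  have Wm: "W \<in> borel_measurable borel"
    and Wb: "\<And>y. y \<in> D \<Longrightarrow> ess_inf_on D V \<le> W y" "\<And>y. y \<in> D \<Longrightarrow> W y \<le> ess_sup_on D V"
    using W by (auto simp: represents_on_def)
  have "\<phi> x \<noteq> 0"
  proof
    assume "\<phi> x = 0"
    then have "\<phi> y = 0" for y using max[of y] by simp
    with eig show False by (simp add: eigenfunction_def)
  qed
  obtain n where n: "norm n = 1" and r0: "0 < r" and half: "\<And>y. y \<in> D \<Longrightarrow> n \<bullet> (y - x) < r"
    unfolding r by (rule convex_in_halfspace_at_infdist[OF D x]) blast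
  \<comment> \<open>The second inequality serves the degenerate case
    \<open>\<Psi> (1 / r\<^sup>2) = 0\<close>, where no optimal time exists and the claim reduces to
    \<open>0 \<le> E\<close>.\<close>
  have main: "1 \<le> exp (E * t) * (1 - p * (1 - exp (1 - t * \<Psi> (1 / r\<^sup>2))))"
    and survival: "1 \<le> exp (E * t)" if t: "0 < t" for t
  proof -
    obtain A where A: "A \<in> sets M" "p * (1 - exp (1 - t * \<Psi> (1 / r\<^sup>2))) \<le> prob A"
      "AE \<omega> in M. \<omega> \<in> A \<longrightarrow> r \<le> n \<bullet> B (S t \<omega>) \<omega>"
      using subordinate_brownian_leaves_halfspace[OF setting _ r0 n, of t] t
      unfolding p_def by auto
    have out: "AE \<omega> in M. \<omega> \<in> A \<longrightarrow> sbm_path S B x \<omega> t \<notin> D"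
      using A(3)
    proof eventually_elim
      fix \<omega> assume "\<omega> \<in> A \<longrightarrow> r \<le> n \<bullet> B (S t \<omega>) \<omega>"
      then show "\<omega> \<in> A \<longrightarrow> sbm_path S B x \<omega> t \<notin> D"
        using half[of "sbm_path S B x \<omega> t"] by (auto simp: sbm_path_def)
    qed
    have "exp (- l * t) * \<bar>\<phi> x\<bar> \<le> exp (- ess_inf_on D V * t) * \<bar>\<phi> x\<bar> * (1 - prob A)"
      using feynman_kac_bound[where \<phi>=\<phi> and K="\<bar>\<phi> x\<bar>", OF setting x t Wm Wb max A(1) out] eq[OF t] by (simp add: abs_mult)
    then have "exp (- l * t) * \<bar>\<phi> x\<bar> \<le> (exp (- ess_inf_on D V * t) * (1 - prob A)) * \<bar>\<phi> x\<bar>"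
      by (simp only: ac_simps)
    then have "exp (- l * t) \<le> exp (- ess_inf_on D V * t) * (1 - prob A)"
      by (rule mult_right_le_imp_le) (simp add: \<open>\<phi> x \<noteq> 0\<close>)
    then have "exp (l * t) * exp (- l * t) \<le> exp (l * t) * (exp (- ess_inf_on D V * t) * (1 - prob A))"
      by (intro mult_left_mono) auto
    moreover have "exp (l * t) * exp (- l * t) = 1" by (simp add: exp_minus)
    moreover have "exp (E * t) = exp (l * t) * exp (- ess_inf_on D V * t)"
      unfolding E_def by (subst exp_add[symmetric]) (simp add: algebra_simps)
    ultimately have *: "1 \<le> exp (E * t) * (1 - prob A)" by (simp only: mult.assoc)
    also have "\<dots> \<le> exp (E * t) * (1 - p * (1 - exp (1 - t * \<Psi> (1 / r\<^sup>2))))"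
      using A(2) by (intro mult_left_mono) auto
    finally show "1 \<le> exp (E * t) * (1 - p * (1 - exp (1 - t * \<Psi> (1 / r\<^sup>2))))" .
    have "exp (E * t) * (1 - prob A) \<le> exp (E * t)" by (intro mult_left_le) auto
    with * show "1 \<le> exp (E * t)" by (rule order_trans)
  qed
  show ?thesis
  proof (cases "\<Psi> (1 / r\<^sup>2) = 0")
    case True
    then show ?thesis using survival[of 1] by (simp add: E_def)
  next
    case False
    with \<Psi> have P: "0 < \<Psi> (1 / r\<^sup>2)" by simp
    obtain \<kappa> where \<kappa>: "is_arg_min theta_fun (\<lambda>\<kappa>. 1 < \<kappa>) \<kappa>" "theta = - theta_fun \<kappa>"
      by (rule theta_fun_minimum)
    then have k: "1 < \<kappa>" by (simp add: is_arg_min_def)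
    define t where "t = \<kappa> / \<Psi> (1 / r\<^sup>2)"
    have t: "0 < t" "t * \<Psi> (1 / r\<^sup>2) = \<kappa>" using P k by (auto simp: t_def)
    define q where "q = 1 - p * (1 - exp (1 - \<kappa>))"
    have "p * (1 - exp (1 - \<kappa>)) < 1 * 1" using p k by (intro mult_strict_mono) auto
    then have q: "0 < q" by (simp add: q_def)
    have "0 \<le> ln (exp (E * t) * q)" using main[OF t(1)] t(2) by (simp add: q_def)
    also have "\<dots> = E * t + ln q" using q by (simp add: ln_mult_pos)
    also have "ln q = \<kappa> * theta_fun \<kappa>" using k by (simp add: theta_fun_def q_def p_def)
    finally have "theta * \<kappa> \<le> E * t" unfolding \<kappa>(2) by (simp add: mult.commute)
    also have "E * t = (E / \<Psi> (1 / r\<^sup>2)) * \<kappa>" by (simp add: t_def)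
    finally have "theta \<le> E / \<Psi> (1 / r\<^sup>2)" using k by (simp only: mult_le_cancel_right_pos)
    then show ?thesis using P by (simp only: pos_le_divide_eq E_def)
  qed
qed

theorem theorem3p2:
  shows "(\<exists>\<kappa>. is_arg_min theta_fun (\<lambda>\<kappa>. 1 < \<kappa>) \<kappa> \<and> theta = - theta_fun \<kappa>) \<and>
    \<bar>theta - 0.0833\<bar> < 1 / 10 ^ 4 \<and>
    0 < theta \<and>
    (\<forall>(M :: 'w measure) (\<Psi> :: real \<Rightarrow> real) (S :: real \<Rightarrow> 'w \<Rightarrow> real)
        (B :: real \<Rightarrow> 'w \<Rightarrow> real ^ 'd) (V :: real ^ 'd \<Rightarrow> real) (D :: (real ^ 'd) set)
        (\<phi> :: real ^ 'd \<Rightarrow> real) (l :: real) (x :: real ^ 'd).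
      bernstein0 \<Psi> \<longrightarrow>
      subordinate_brownian_setting M \<Psi> S B \<longrightarrow>
      Linfty V \<longrightarrow>
      bounded D \<longrightarrow> convex D \<longrightarrow> open D \<longrightarrow>
      eigenfunction M S B D V l \<phi> \<longrightarrow>
      x \<in> D \<longrightarrow> (\<forall>y. \<bar>\<phi> y\<bar> \<le> \<bar>\<phi> x\<bar>) \<longrightarrow>
      (let r = infdist x (frontier D);
           E = Linfty_norm_on D (\<lambda>y. max (- V y) 0) - ess_inf_on D (\<lambda>y. max (V y) 0) + l
       in E \<ge> theta * \<Psi> (1 / r\<^sup>2) \<and>
          (strict_mono_on {0<..} \<Psi> \<longrightarrow> r \<ge> recip_sqrt (inverse_ext \<Psi> (E / theta)))))"
proof -
  obtain \<kappa> where \<kappa>: "is_arg_min theta_fun (\<lambda>\<kappa>. 1 < \<kappa>) \<kappa>" "theta = - theta_fun \<kappa>"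
    and theta: "0.0832 < theta" "theta < 0.0834"
    by (rule theta_fun_minimum)
  have theta0: "0 < theta" using theta by simp
  show ?thesis unfolding Let_def
  proof (intro conjI allI impI exI[of _ \<kappa>] \<kappa> theta0)
    show "\<bar>theta - 0.0833\<bar> < 1 / 10 ^ 4" using theta by linarith
  next
    fix M :: "'w measure" and \<Psi> :: "real \<Rightarrow> real" and S :: "real \<Rightarrow> 'w \<Rightarrow> real"
      and B :: "real \<Rightarrow> 'w \<Rightarrow> real ^ 'd" and V :: "real ^ 'd \<Rightarrow> real" and D :: "(real ^ 'd) set"
      and \<phi> :: "real ^ 'd \<Rightarrow> real" and l :: real and x :: "real ^ 'd"
    assume bern: "bernstein0 \<Psi>" and setting: "subordinate_brownian_setting M \<Psi> S B"
      and V: "Linfty V" and D: "bounded D" "convex D" "open D"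
      and eig: "eigenfunction M S B D V l \<phi>" and x: "x \<in> D" and max: "\<forall>y. \<bar>\<phi> y\<bar> \<le> \<bar>\<phi> x\<bar>"
    define r where "r = infdist x (frontier D)"
    define E where "E = Linfty_norm_on D (\<lambda>y. max (- V y) 0) - ess_inf_on D (\<lambda>y. max (V y) 0) + l"
    have r: "0 < r" unfolding r_def by (rule convex_in_halfspace_at_infdist[OF D x])
    have P: "0 \<le> \<Psi> (1 / r\<^sup>2)" using bern r by (simp add: bernstein0_def)
    have nonempty: "D \<noteq> {}" using x by auto
    have "theta * \<Psi> (1 / r\<^sup>2) \<le> l - ess_inf_on D V"
      by (rule eigenfunction_maximum_bound[OF P setting V D eig x max[rule_format] r_def])
    also have "\<dots> \<le> E"
      using ess_inf_on_decomposition[OF D(3) nonempty V] unfolding E_def by linarith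
    finally have bound: "theta * \<Psi> (1 / r\<^sup>2) \<le> E" .
    then show "theta * \<Psi> (1 / (infdist x (frontier D))\<^sup>2)
        \<le> Linfty_norm_on D (\<lambda>y. max (- V y) 0) - ess_inf_on D (\<lambda>y. max (V y) 0) + l"
      unfolding r_def E_def .
    assume mono: "strict_mono_on {0<..} \<Psi>"
    have "recip_sqrt (inverse_ext \<Psi> (E / theta)) \<le> r"
    \<comment> \<open>Outside the range of \<Psi> the extended inverse is infinite and the lower
      bound for \<open>r\<close> is 0.\<close>
    proof (cases "E / theta \<in> \<Psi> ` {0<..}")
      case False
      then show ?thesis using r by (simp add: inverse_ext_def recip_sqrt_def)
    next
      case True
      then obtain u where u: "0 < u" "E / theta = \<Psi> u" by auto
      have "the_inv_into {0<..} \<Psi> (\<Psi> u) = u"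
        using u strict_mono_on_imp_inj_on[OF mono] by (intro the_inv_into_f_f) auto
      then have "recip_sqrt (inverse_ext \<Psi> (E / theta)) = 1 / sqrt u"
        using True u by (simp add: inverse_ext_def recip_sqrt_def)
      moreover have "\<Psi> (1 / r\<^sup>2) \<le> \<Psi> u"
        unfolding u(2)[symmetric] pos_le_divide_eq[OF theta0] using bound by (simp only: mult.commute)
      \<comment> \<open>Strict monotonicity is used in contrapositive form, which compares the
        arguments without inverting \<Psi> at \<open>1 / r\<^sup>2\<close>.\<close>
      then have "\<not> u < 1 / r\<^sup>2"
        using strict_mono_onD[OF mono, of u "1 / r\<^sup>2"] u(1) r by auto
      then have "sqrt (1 / r\<^sup>2) \<le> sqrt u" by (simp only: not_less real_sqrt_le_iff)
      then have "1 / r \<le> sqrt u" using r by (simp add: real_sqrt_divide)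
      then have "1 / sqrt u \<le> r" using r u(1) by (simp add: pos_divide_le_eq mult.commute)
      ultimately show ?thesis by simp
    qed
    then show "recip_sqrt (inverse_ext \<Psi> ((Linfty_norm_on D (\<lambda>y. max (- V y) 0)
        - ess_inf_on D (\<lambda>y. max (V y) 0) + l) / theta)) \<le> infdist x (frontier D)"
      unfolding r_def E_def .
  qed
qed

end
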